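(* Work in $\mathbf{CZF}$ and assume finitary NID. Then for every set-presented formal space $(\mathbb P,\le,\triangleleft)$, the class of points of the formal space is set-generated (as a class of subsets of $\mathbb P$).
   Context: A formal space consists of a set $\mathbb P$ with a preorder $\le$ and a class relation $\triangleleft$ between elements of $\mathbb P$ and subsets of $\mathbb P$ ("$a$ is covered by $U$"; $\mathrm{Cov}(a)=\{U: a\triangleleft U\}$) such that: $a\in U$ implies $a\triangleleft U$; if $a\triangleleft U$ and $u\triangleleft V$ for all $u\in U$ then $a\triangleleft V$; if $a\le b$ and $b\triangleleft U$ then $a\triangleleft U$; if $a\triangleleft U$ and $a\triangleleft V$ then $a\triangleleft{\downarrow}U\cap{\downarrow}V$, where ${\downarrow}U=\{c: \exists u\in U\,c\le u\}$. It is set-presented if there is a function $\mathrm{BCov}$ assigning to each $a\in\mathbb P$ a set $\mathrm{BCov}(a)$ of subsets of $\mathbb P$ such that $a\triangleleft U$ iff $S\subseteq U$ for some $S\in\mathrm{BCov}(a)$. A point is an inhabited subset $\alpha\subseteq\mathbb P$ that is upwards closed, downwards directed (for $p,q\in\alpha$ there is $r\in\alpha$ with $r\le p$, $r\le q$), and such that $a\in\alpha$ and $a\triangleleft S$ imply $S\cap\alpha$ inhabited. A class $\mathcal C$ of subsets of a set $X$ is set-generated if there is a set $G\subseteq\mathcal C$ with $\forall\alpha\in\mathcal C\,\forall x\in\alpha\,\exists\beta\in G\,x\in\beta\subseteq\alpha$. Finitary NID: for every set $X$ and set $\mathcal R$ of finitary rules on $X$ (pairs $(a,b)$ of subsets of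 $X$ with $a$ the image of some $\{1,\dots,n\}$), the class of $Y\subseteq X$ closed under all rules ($a\subseteq Y$ implies $b\cap Y$ inhabited) is set-generated. *)

theory Defs
  imports Main
begin

section \<open>Intuitionistic first-order logic with equality over the language of set theory\<close>

text \<open>Formulas with de Bruijn indices. Variables are the only terms, so substitution is renaming.
  Negation is implication of falsity.\<close>

datatype fm =
    Fls
  | Mem nat nat
  | Eq nat nat
  | And fm fm
  | Or fm fm
  | Imp fm fm
  | All fm
  | Ex fm

primrec ren :: "(nat \<Rightarrow> nat) \<Rightarrow> fm \<Rightarrow> fm" where
  "ren f Fls = Fls"
| "ren f (Mem x y) = Mem (f x) (f y)"
| "ren f (Eq x y) = Eq (f x) (f y)"
| "ren f (And p q) = And (ren f p) (ren f q)"
| "ren f (Or p q) = Or (ren f p) (ren f q)"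
| "ren f (Imp p q) = Imp (ren f p) (ren f q)"
| "ren f (All p) = All (ren (case_nat 0 (\<lambda>n. Suc (f n))) p)"
| "ren f (Ex p) = Ex (ren (case_nat 0 (\<lambda>n. Suc (f n))) p)"

definition lift :: "fm \<Rightarrow> fm" where
  "lift p = ren Suc p"

definition inst :: "nat \<Rightarrow> fm \<Rightarrow> fm" where
  "inst t p = ren (case_nat t (\<lambda>n. n)) p"

text \<open>Natural deduction from a set \<open>T\<close> of axioms and a set \<open>H\<close> of hypotheses. Only the
  hypotheses are shifted by the quantifier rules: free variables of an axiom are parameters, that is,
  axioms stand for their universal closures.\<close>

inductive deriv :: "fm set \<Rightarrow> fm set \<Rightarrow> fm \<Rightarrow> bool" for T :: "fm set" where
  Ax: "p \<in> T \<Longrightarrow> deriv T H p"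
| Hyp: "p \<in> H \<Longrightarrow> deriv T H p"
| FlsE: "deriv T H Fls \<Longrightarrow> deriv T H p"
| AndI: "deriv T H p \<Longrightarrow> deriv T H q \<Longrightarrow> deriv T H (And p q)"
| AndE1: "deriv T H (And p q) \<Longrightarrow> deriv T H p"
| AndE2: "deriv T H (And p q) \<Longrightarrow> deriv T H q"
| OrI1: "deriv T H p \<Longrightarrow> deriv T H (Or p q)"
| OrI2: "deriv T H q \<Longrightarrow> deriv T H (Or p q)"
| OrE: "deriv T H (Or p q) \<Longrightarrow> deriv T (insert p H) r \<Longrightarrow> deriv T (insert q H) r \<Longrightarrow> deriv T H r"
| ImpI: "deriv T (insert p H) q \<Longrightarrow> deriv T H (Imp p q)"
| ImpE: "deriv T H (Imp p q) \<Longrightarrow> deriv T H p \<Longrightarrow> deriv T H q"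
| AllI: "deriv T (lift ` H) p \<Longrightarrow> deriv T H (All p)"
| AllE: "deriv T H (All p) \<Longrightarrow> deriv T H (inst t p)"
| ExI: "deriv T H (inst t p) \<Longrightarrow> deriv T H (Ex p)"
| ExE: "deriv T H (Ex p) \<Longrightarrow> deriv T (insert p (lift ` H)) (lift q) \<Longrightarrow> deriv T H q"
| EqRefl: "deriv T H (Eq t t)"
| EqSubst: "deriv T H (Eq s t) \<Longrightarrow> deriv T H (inst s p) \<Longrightarrow> deriv T H (inst t p)"

definition provable :: "fm set \<Rightarrow> fm \<Rightarrow> bool"  (infix \<open>\<turnstile>\<close> 50) where
  "T \<turnstile> p \<longleftrightarrow> deriv T {} p"

text \<open>The bounded formulas. The bound \<open>Suc y\<close> is never the quantified variable.\<close>

inductive bounded :: "fm \<Rightarrow> bool" where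
  "bounded Fls"
| "bounded (Mem x y)"
| "bounded (Eq x y)"
| "bounded p \<Longrightarrow> bounded q \<Longrightarrow> bounded (And p q)"
| "bounded p \<Longrightarrow> bounded q \<Longrightarrow> bounded (Or p q)"
| "bounded p \<Longrightarrow> bounded q \<Longrightarrow> bounded (Imp p q)"
| "bounded p \<Longrightarrow> bounded (All (Imp (Mem 0 (Suc y)) p))"
| "bounded p \<Longrightarrow> bounded (Ex (And (Mem 0 (Suc y)) p))"

section \<open>Notation with named bound variables\<close>

text \<open>To write formulas with names, variables are given by de Bruijn levels: a \<open>form\<close> yields a
  formula once the number \<open>d\<close> of enclosing quantifiers is known, a quantifier binds the level \<open>d\<close>,
  and level \<open>x\<close> has index \<open>d - Suc x\<close> at depth \<open>d\<close>. A \<open>form\<close> is read as a formula at depth \<open>0\<close>.\<close>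

type_synonym form = "nat \<Rightarrow> fm"

definition formula :: "form \<Rightarrow> fm" where
  "formula F = F 0"

definition mem :: "nat \<Rightarrow> nat \<Rightarrow> form"  (infix \<open>\<^bold>\<in>\<close> 50) where
  "(x \<^bold>\<in> y) = (\<lambda>d. Mem (d - Suc x) (d - Suc y))"

definition eq :: "nat \<Rightarrow> nat \<Rightarrow> form"  (infix \<open>\<^bold>=\<close> 50) where
  "(x \<^bold>= y) = (\<lambda>d. Eq (d - Suc x) (d - Suc y))"

definition conj :: "form \<Rightarrow> form \<Rightarrow> form"  (infixr \<open>\<^bold>\<and>\<close> 35) where
  "(F \<^bold>\<and> G) = (\<lambda>d. And (F d) (G d))"

definition disj :: "form \<Rightarrow> form \<Rightarrow> form"  (infixr \<open>\<^bold>\<or>\<close> 30) where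
  "(F \<^bold>\<or> G) = (\<lambda>d. Or (F d) (G d))"

definition imp :: "form \<Rightarrow> form \<Rightarrow> form"  (infixr \<open>\<^bold>\<longrightarrow>\<close> 25) where
  "(F \<^bold>\<longrightarrow> G) = (\<lambda>d. Imp (F d) (G d))"

definition iff :: "form \<Rightarrow> form \<Rightarrow> form"  (infixr \<open>\<^bold>\<longleftrightarrow>\<close> 25) where
  "(F \<^bold>\<longleftrightarrow> G) = ((F \<^bold>\<longrightarrow> G) \<^bold>\<and> (G \<^bold>\<longrightarrow> F))"

definition falsity :: form  (\<open>\<^bold>\<bottom>\<close>) where
  "\<^bold>\<bottom> = (\<lambda>d. Fls)"

definition all :: "(nat \<Rightarrow> form) \<Rightarrow> form"  (binder \<open>\<^bold>\<forall>\<close> 10) where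
  "all F = (\<lambda>d. All (F d (Suc d)))"

definition ex :: "(nat \<Rightarrow> form) \<Rightarrow> form"  (binder \<open>\<^bold>\<exists>\<close> 10) where
  "ex F = (\<lambda>d. Ex (F d (Suc d)))"

definition all_in :: "nat \<Rightarrow> (nat \<Rightarrow> form) \<Rightarrow> form" where
  "all_in a F = (\<^bold>\<forall>x. x \<^bold>\<in> a \<^bold>\<longrightarrow> F x)"

definition ex_in :: "nat \<Rightarrow> (nat \<Rightarrow> form) \<Rightarrow> form" where
  "ex_in a F = (\<^bold>\<exists>x. x \<^bold>\<in> a \<^bold>\<and> F x)"

definition subset :: "nat \<Rightarrow> nat \<Rightarrow> form"  (infix \<open>\<^bold>\<subseteq>\<close> 50) where
  "(x \<^bold>\<subseteq> y) = (\<^bold>\<forall>z. z \<^bold>\<in> x \<^bold>\<longrightarrow> z \<^bold>\<in> y)"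

definition all_sub :: "nat \<Rightarrow> (nat \<Rightarrow> form) \<Rightarrow> form" where
  "all_sub a F = (\<^bold>\<forall>x. x \<^bold>\<subseteq> a \<^bold>\<longrightarrow> F x)"

syntax
  "_all_in" :: "pttrn \<Rightarrow> nat \<Rightarrow> form \<Rightarrow> form"  (\<open>(3\<^bold>\<forall>_\<^bold>\<in>_./ _)\<close> [0, 0, 10] 10)
  "_ex_in" :: "pttrn \<Rightarrow> nat \<Rightarrow> form \<Rightarrow> form"  (\<open>(3\<^bold>\<exists>_\<^bold>\<in>_./ _)\<close> [0, 0, 10] 10)
  "_all_sub" :: "pttrn \<Rightarrow> nat \<Rightarrow> form \<Rightarrow> form"  (\<open>(3\<^bold>\<forall>_\<^bold>\<subseteq>_./ _)\<close> [0, 0, 10] 10)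
translations
  "\<^bold>\<forall>x\<^bold>\<in>a. F" \<rightleftharpoons> "CONST all_in a (\<lambda>x. F)"
  "\<^bold>\<exists>x\<^bold>\<in>a. F" \<rightleftharpoons> "CONST ex_in a (\<lambda>x. F)"
  "\<^bold>\<forall>x\<^bold>\<subseteq>a. F" \<rightleftharpoons> "CONST all_sub a (\<lambda>x. F)"

text \<open>A formula \<open>p\<close> as a class (of \<open>n\<close>-tuples, \<open>n\<close> the length of \<open>xs\<close>): its indices below \<open>n\<close>
  are the arguments; its other indices are the parameters and remain free, index \<open>n + k\<close> becoming the
  \<open>k\<close>-th free variable of the whole formula.\<close>

definition app :: "fm \<Rightarrow> nat list \<Rightarrow> form" where
  "app p xs = (\<lambda>d. ren (\<lambda>i. if i < length xs then d - Suc (xs ! i) else d + (i - length xs)) p)"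

definition class_rel :: "fm \<Rightarrow> nat \<Rightarrow> nat \<Rightarrow> form" where
  "class_rel p x y = app p [x, y]"

section \<open>Set-theoretic notions\<close>

definition is_empty :: "nat \<Rightarrow> form" where
  "is_empty x = (\<^bold>\<forall>z. z \<^bold>\<in> x \<^bold>\<longrightarrow> \<^bold>\<bottom>)"

definition is_succ :: "nat \<Rightarrow> nat \<Rightarrow> form" where
  "is_succ y x = (\<^bold>\<forall>z. z \<^bold>\<in> y \<^bold>\<longleftrightarrow> z \<^bold>\<in> x \<^bold>\<or> z \<^bold>= x)"

definition is_inductive :: "nat \<Rightarrow> form" where
  "is_inductive w = ((\<^bold>\<exists>e\<^bold>\<in>w. is_empty e) \<^bold>\<and> (\<^bold>\<forall>x\<^bold>\<in>w. \<^bold>\<exists>y\<^bold>\<in>w. is_succ y x))"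

definition is_omega :: "nat \<Rightarrow> form" where
  "is_omega w = (is_inductive w \<^bold>\<and> (\<^bold>\<forall>b. is_inductive b \<^bold>\<longrightarrow> w \<^bold>\<subseteq> b))"

text \<open>\<open>z = {{x}, {x, y}}\<close>\<close>

definition is_pair :: "nat \<Rightarrow> nat \<Rightarrow> nat \<Rightarrow> form" where
  "is_pair z x y = (\<^bold>\<forall>w. w \<^bold>\<in> z \<^bold>\<longleftrightarrow>
     (\<^bold>\<forall>v. v \<^bold>\<in> w \<^bold>\<longleftrightarrow> v \<^bold>= x) \<^bold>\<or> (\<^bold>\<forall>v. v \<^bold>\<in> w \<^bold>\<longleftrightarrow> v \<^bold>= x \<^bold>\<or> v \<^bold>= y))"

definition related :: "nat \<Rightarrow> nat \<Rightarrow> nat \<Rightarrow> form" where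
  "related r x y = (\<^bold>\<exists>z\<^bold>\<in>r. is_pair z x y)"

definition is_function_on :: "nat \<Rightarrow> nat \<Rightarrow> form" where
  "is_function_on f D =
     ((\<^bold>\<forall>z\<^bold>\<in>f. \<^bold>\<exists>x\<^bold>\<in>D. \<^bold>\<exists>y. is_pair z x y) \<^bold>\<and>
      (\<^bold>\<forall>x\<^bold>\<in>D. \<^bold>\<exists>y. related f x y \<^bold>\<and> (\<^bold>\<forall>y'. related f x y' \<^bold>\<longrightarrow> y' \<^bold>= y)))"

definition is_image :: "nat \<Rightarrow> nat \<Rightarrow> nat \<Rightarrow> form" where
  "is_image a f D = (\<^bold>\<forall>y. y \<^bold>\<in> a \<^bold>\<longleftrightarrow> (\<^bold>\<exists>x\<^bold>\<in>D. related f x y))"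

text \<open>\<open>D = {1, \<dots>, n}\<close>, that is, \<open>D = {m + 1 | m \<in> n}\<close> for a von Neumann numeral \<open>n\<close>.\<close>

definition is_initial_segment :: "nat \<Rightarrow> nat \<Rightarrow> form" where
  "is_initial_segment D n = (\<^bold>\<forall>k. k \<^bold>\<in> D \<^bold>\<longleftrightarrow> (\<^bold>\<exists>m\<^bold>\<in>n. is_succ k m))"

definition is_finite :: "nat \<Rightarrow> form" where
  "is_finite a = (\<^bold>\<exists>w. is_omega w \<^bold>\<and> (\<^bold>\<exists>n\<^bold>\<in>w. \<^bold>\<exists>D. is_initial_segment D n \<^bold>\<and>
     (\<^bold>\<exists>f. is_function_on f D \<^bold>\<and> is_image a f D)))"

section \<open>The theory CZF\<close>

inductive_set CZF :: "fm set" where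
  Extensionality: "formula (\<^bold>\<forall>a b. (\<^bold>\<forall>x. x \<^bold>\<in> a \<^bold>\<longleftrightarrow> x \<^bold>\<in> b) \<^bold>\<longrightarrow> a \<^bold>= b) \<in> CZF"
| Pairing: "formula (\<^bold>\<forall>a b. \<^bold>\<exists>c. \<^bold>\<forall>x. x \<^bold>\<in> c \<^bold>\<longleftrightarrow> x \<^bold>= a \<^bold>\<or> x \<^bold>= b) \<in> CZF"
| Union: "formula (\<^bold>\<forall>a. \<^bold>\<exists>c. \<^bold>\<forall>x. x \<^bold>\<in> c \<^bold>\<longleftrightarrow> (\<^bold>\<exists>y\<^bold>\<in>a. x \<^bold>\<in> y)) \<in> CZF"
| Strong_Infinity: "formula (\<^bold>\<exists>w. is_omega w) \<in> CZF"
| Set_Induction: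
    "formula ((\<^bold>\<forall>a. (\<^bold>\<forall>x\<^bold>\<in>a. app p [x]) \<^bold>\<longrightarrow> app p [a]) \<^bold>\<longrightarrow> (\<^bold>\<forall>a. app p [a])) \<in> CZF"
| Bounded_Separation:
    "bounded p \<Longrightarrow> formula (\<^bold>\<forall>a. \<^bold>\<exists>b. \<^bold>\<forall>x. x \<^bold>\<in> b \<^bold>\<longleftrightarrow> x \<^bold>\<in> a \<^bold>\<and> app p [x]) \<in> CZF"
| Strong_Collection:
    "formula (\<^bold>\<forall>a. (\<^bold>\<forall>x\<^bold>\<in>a. \<^bold>\<exists>y. app p [x, y]) \<^bold>\<longrightarrow>
       (\<^bold>\<exists>b. (\<^bold>\<forall>x\<^bold>\<in>a. \<^bold>\<exists>y\<^bold>\<in>b. app p [x, y]) \<^bold>\<and> (\<^bold>\<forall>y\<^bold>\<in>b. \<^bold>\<exists>x\<^bold>\<in>a. app p [x, y]))) \<in> CZF"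
| Subset_Collection:
    "formula (\<^bold>\<forall>a b. \<^bold>\<exists>c. \<^bold>\<forall>u. (\<^bold>\<forall>x\<^bold>\<in>a. \<^bold>\<exists>y\<^bold>\<in>b. app p [x, y, u]) \<^bold>\<longrightarrow>
       (\<^bold>\<exists>d\<^bold>\<in>c. (\<^bold>\<forall>x\<^bold>\<in>a. \<^bold>\<exists>y\<^bold>\<in>d. app p [x, y, u]) \<^bold>\<and>
              (\<^bold>\<forall>y\<^bold>\<in>d. \<^bold>\<exists>x\<^bold>\<in>a. app p [x, y, u]))) \<in> CZF"

section \<open>Set-generated classes and finitary NID\<close>

definition set_generated :: "(nat \<Rightarrow> form) \<Rightarrow> form" where
  "set_generated C = (\<^bold>\<exists>G. (\<^bold>\<forall>b\<^bold>\<in>G. C b) \<^bold>\<and>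
     (\<^bold>\<forall>a. C a \<^bold>\<longrightarrow> (\<^bold>\<forall>x\<^bold>\<in>a. \<^bold>\<exists>b\<^bold>\<in>G. x \<^bold>\<in> b \<^bold>\<and> b \<^bold>\<subseteq> a)))"

definition finitary_rule_set :: "nat \<Rightarrow> nat \<Rightarrow> form" where
  "finitary_rule_set X R =
     (\<^bold>\<forall>r\<^bold>\<in>R. \<^bold>\<exists>a b. is_pair r a b \<^bold>\<and> a \<^bold>\<subseteq> X \<^bold>\<and> b \<^bold>\<subseteq> X \<^bold>\<and> is_finite a)"

definition closed_subset :: "nat \<Rightarrow> nat \<Rightarrow> nat \<Rightarrow> form" where
  "closed_subset X R Y = (Y \<^bold>\<subseteq> X \<^bold>\<and>
     (\<^bold>\<forall>r\<^bold>\<in>R. \<^bold>\<forall>a b. is_pair r a b \<^bold>\<longrightarrow> a \<^bold>\<subseteq> Y \<^bold>\<longrightarrow> (\<^bold>\<exists>x\<^bold>\<in>b. x \<^bold>\<in> Y)))"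

definition finitary_NID :: form where
  "finitary_NID = (\<^bold>\<forall>X R. finitary_rule_set X R \<^bold>\<longrightarrow> set_generated (closed_subset X R))"

section \<open>Formal spaces and their points\<close>

text \<open>The preorder \<open>L\<close> is a set of ordered pairs. The cover \<open>cov\<close> is a class relation; only its
  restriction to elements and subsets of \<open>P\<close> matters.\<close>

definition preorder_on :: "nat \<Rightarrow> nat \<Rightarrow> form" where
  "preorder_on P L =
     ((\<^bold>\<forall>z\<^bold>\<in>L. \<^bold>\<exists>a\<^bold>\<in>P. \<^bold>\<exists>b\<^bold>\<in>P. is_pair z a b) \<^bold>\<and>
      (\<^bold>\<forall>a\<^bold>\<in>P. related L a a) \<^bold>\<and>
      (\<^bold>\<forall>a\<^bold>\<in>P. \<^bold>\<forall>b\<^bold>\<in>P. \<^bold>\<forall>c\<^bold>\<in>P. related L a b \<^bold>\<and> related L b c \<^bold>\<longrightarrow> related L a c))"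

definition in_down :: "nat \<Rightarrow> nat \<Rightarrow> nat \<Rightarrow> form" where
  "in_down L U c = (\<^bold>\<exists>u\<^bold>\<in>U. related L c u)"

definition formal_space :: "nat \<Rightarrow> nat \<Rightarrow> (nat \<Rightarrow> nat \<Rightarrow> form) \<Rightarrow> form" where
  "formal_space P L cov =
     (preorder_on P L \<^bold>\<and>
      (\<^bold>\<forall>a\<^bold>\<in>P. \<^bold>\<forall>U\<^bold>\<subseteq>P. a \<^bold>\<in> U \<^bold>\<longrightarrow> cov a U) \<^bold>\<and>
      (\<^bold>\<forall>a\<^bold>\<in>P. \<^bold>\<forall>U\<^bold>\<subseteq>P. \<^bold>\<forall>V\<^bold>\<subseteq>P. cov a U \<^bold>\<and> (\<^bold>\<forall>u\<^bold>\<in>U. cov u V) \<^bold>\<longrightarrow> cov a V) \<^bold>\<and>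
      (\<^bold>\<forall>a\<^bold>\<in>P. \<^bold>\<forall>b\<^bold>\<in>P. \<^bold>\<forall>U\<^bold>\<subseteq>P. related L a b \<^bold>\<and> cov b U \<^bold>\<longrightarrow> cov a U) \<^bold>\<and>
      (\<^bold>\<forall>a\<^bold>\<in>P. \<^bold>\<forall>U\<^bold>\<subseteq>P. \<^bold>\<forall>V\<^bold>\<subseteq>P. cov a U \<^bold>\<and> cov a V \<^bold>\<longrightarrow>
         (\<^bold>\<exists>W. (\<^bold>\<forall>c. c \<^bold>\<in> W \<^bold>\<longleftrightarrow> in_down L U c \<^bold>\<and> in_down L V c) \<^bold>\<and> cov a W)))"

definition set_presented :: "nat \<Rightarrow> (nat \<Rightarrow> nat \<Rightarrow> form) \<Rightarrow> form" where
  "set_presented P cov =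
     (\<^bold>\<exists>BCov. is_function_on BCov P \<^bold>\<and>
        (\<^bold>\<forall>a\<^bold>\<in>P. \<^bold>\<exists>B. related BCov a B \<^bold>\<and> (\<^bold>\<forall>S\<^bold>\<in>B. S \<^bold>\<subseteq> P) \<^bold>\<and>
           (\<^bold>\<forall>U\<^bold>\<subseteq>P. cov a U \<^bold>\<longleftrightarrow> (\<^bold>\<exists>S\<^bold>\<in>B. S \<^bold>\<subseteq> U))))"

definition point :: "nat \<Rightarrow> nat \<Rightarrow> (nat \<Rightarrow> nat \<Rightarrow> form) \<Rightarrow> nat \<Rightarrow> form" where
  "point P L cov \<alpha> =
     (\<alpha> \<^bold>\<subseteq> P \<^bold>\<and>
      (\<^bold>\<exists>p. p \<^bold>\<in> \<alpha>) \<^bold>\<and>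
      (\<^bold>\<forall>p\<^bold>\<in>\<alpha>. \<^bold>\<forall>q\<^bold>\<in>P. related L p q \<^bold>\<longrightarrow> q \<^bold>\<in> \<alpha>) \<^bold>\<and>
      (\<^bold>\<forall>p\<^bold>\<in>\<alpha>. \<^bold>\<forall>q\<^bold>\<in>\<alpha>. \<^bold>\<exists>r\<^bold>\<in>\<alpha>. related L r p \<^bold>\<and> related L r q) \<^bold>\<and>
      (\<^bold>\<forall>a\<^bold>\<in>\<alpha>. \<^bold>\<forall>S\<^bold>\<subseteq>P. cov a S \<^bold>\<longrightarrow> (\<^bold>\<exists>x\<^bold>\<in>S. x \<^bold>\<in> \<alpha>)))"

end

theory Submission
  imports Defs "HOL-Library.Countable" "HOL-Library.Infinite_Set"
begin

text \<open>The points of a set-presented formal space are the subsets of \<open>\<bbbP>\<close> closed under the finitary rules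
  \<open>(\<emptyset>, \<bbbP>)\<close>, \<open>({p, q}, {r. r \<le> p \<and> r \<le> q})\<close> and \<open>({a}, S)\<close> for \<open>S \<in> BCov a\<close>; upward closure needs no
  rule of its own, since \<open>p \<le> q\<close> implies that \<open>p\<close> is covered by \<open>{q}\<close>. By Bounded Separation, Strong
  Collection and Union these rules form a set, to which finitary NID applies.

  The formal derivation is obtained from the completeness of intuitionistic logic for Kripke models:
  the argument is carried out at the worlds of an arbitrary Kripke model of CZF and finitary NID.\<close>

section \<open>Renaming\<close>

text \<open>Strong Collection produces sets of rules without pinning them down: a collected rule is
  only known to satisfy the formula under which it was collected. Two conditions on the set R of
  rules make this harmless. Every rule in R is sound, that is, finitary and obeyed by all points;
  and R has enough rules, that is, for all p, q and for every cover S of a it contains a rule with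
  the wanted premise and a conclusion inside the wanted set. Soundness makes points closed,
  sufficiency makes closed subsets points, and nothing has to be chosen. The covers S of a form a
  class over which nothing can be collected; collection runs over BCov(a), and the rule of a basic
  cover also serves the larger covers.

  Working with forcing replaces formal derivations by statements about worlds, in which sets are
  named objects and a forced disjunction may be split into cases. The price is that every fact must
  be available at later worlds, and that the nested worlds introduced by nested quantifiers have to
  be merged.\<close>

lemma ren_ren: "ren f (ren g p) = ren (f \<circ> g) p"
proof (induction p arbitrary: f g)
  case (All p)
  have "case_nat 0 (\<lambda>n. Suc (f n)) \<circ> case_nat 0 (\<lambda>n. Suc (g n)) = case_nat 0 (\<lambda>n. Suc ((f \<circ> g) n))"
    by (auto split: nat.split)
  then show ?case by (simp add: All)
next
  case (Ex p)
  have "case_nat 0 (\<lambda>n. Suc (f n)) \<circ> case_nat 0 (\<lambda>n. Suc (g n)) = case_nat 0 (\<lambda>n. Suc ((f \<circ> g) n))"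
    by (auto split: nat.split)
  then show ?case by (simp add: Ex)
qed auto

primrec fv :: "fm \<Rightarrow> nat set" where
  "fv Fls = {}"
| "fv (Mem x y) = {x, y}"
| "fv (Eq x y) = {x, y}"
| "fv (And p q) = fv p \<union> fv q"
| "fv (Or p q) = fv p \<union> fv q"
| "fv (Imp p q) = fv p \<union> fv q"
| "fv (All p) = {n. Suc n \<in> fv p}"
| "fv (Ex p) = {n. Suc n \<in> fv p}"

lemma finite_fv [simp]: "finite (fv p)"
proof (induction p)
  case (All p)
  have "{n. Suc n \<in> fv p} \<subseteq> (\<lambda>n. n - 1) ` fv p" by force
  then show ?case using All finite_surj by auto
next
  case (Ex p)
  have "{n. Suc n \<in> fv p} \<subseteq> (\<lambda>n. n - 1) ` fv p" by force
  then show ?case using Ex finite_surj by auto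
qed auto

lemma fv_ren: "fv (ren f p) = f ` fv p"
proof (induction p arbitrary: f)
  case (All p)
  then show ?case by (auto simp: image_iff gr0_conv_Suc split: nat.splits)
next
  case (Ex p)
  then show ?case by (auto simp: image_iff gr0_conv_Suc split: nat.splits)
qed auto

lemma ren_cong: "\<forall>n\<in>fv p. f n = g n \<Longrightarrow> ren f p = ren g p"
proof (induction p arbitrary: f g)
  case (All p)
  have "ren (case_nat 0 (\<lambda>n. Suc (f n))) p = ren (case_nat 0 (\<lambda>n. Suc (g n))) p"
    using All.prems by (intro All.IH) (auto split: nat.split)
  then show ?case by simp
next
  case (Ex p)
  have "ren (case_nat 0 (\<lambda>n. Suc (f n))) p = ren (case_nat 0 (\<lambda>n. Suc (g n))) p"
    using Ex.prems by (intro Ex.IH) (auto split: nat.split)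
  then show ?case by simp
next
  case (And p q)
  show ?case using And.prems And.IH[of f g] by (simp add: ball_Un)
next
  case (Or p q)
  show ?case using Or.prems Or.IH[of f g] by (simp add: ball_Un)
next
  case (Imp p q)
  show ?case using Imp.prems Imp.IH[of f g] by (simp add: ball_Un)
qed auto

lemma ren_ident [simp]: "ren (\<lambda>n. n) p = p"
proof (induction p)
  case (All p)
  moreover have "case_nat 0 Suc = (\<lambda>n. n)" by (auto split: nat.split)
  ultimately show ?case by simp
next
  case (Ex p)
  moreover have "case_nat 0 Suc = (\<lambda>n. n)" by (auto split: nat.split)
  ultimately show ?case by simp
qed auto

lemma ren_id: "\<forall>n\<in>fv p. f n = n \<Longrightarrow> ren f p = p"
  using ren_cong[of p f "\<lambda>n. n"] by simp

text \<open>The composite sends index 0 to \<open>t\<close> and \<open>Suc n\<close> to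
  \<open>f n\<close>. In this form instances of a quantified formula match environments extended by
  \<open>case_nat\<close>, which is what the quantifier cases of \<open>truth\<close>
  compare.\<close>

lemma inst_ren: "inst t (ren (case_nat 0 (\<lambda>n. Suc (f n))) p) = ren (case_nat t f) p"
  unfolding inst_def ren_ren by (rule arg_cong2[where f=ren]) (auto split: nat.split)

lemma ren_inst: "ren f (inst t p) = inst (f t) (ren (case_nat 0 (\<lambda>n. Suc (f n))) p)"
  unfolding inst_ren unfolding inst_def ren_ren
  by (rule arg_cong2[where f=ren]) (auto split: nat.split)

lemma ren_lift: "ren (case_nat 0 (\<lambda>n. Suc (f n))) (lift p) = lift (ren f p)"
  unfolding lift_def ren_ren by (rule arg_cong2[where f=ren]) auto

lemma fv_inst: "fv (inst t p) \<subseteq> insert t (fv (All p))"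
  unfolding inst_def fv_ren by (auto split: nat.split)

section \<open>Derivations\<close>

lemma deriv_mono: "deriv T H p \<Longrightarrow> H \<subseteq> H' \<Longrightarrow> deriv T H' p"
proof (induction arbitrary: H' rule: deriv.induct)
  case (OrE H p q r)
  then show ?case by (meson deriv.OrE insert_mono)
next
  case (ImpI p H q)
  then show ?case by (meson deriv.ImpI insert_mono)
next
  case (ExE H p q)
  then show ?case by (meson deriv.ExE image_mono insert_mono)
next
  case (AllI H p)
  then show ?case by (meson deriv.AllI image_mono)
next
  case (EqSubst H s t p)
  then show ?case by (meson deriv.EqSubst)
qed (auto intro: deriv.intros)

text \<open>Without hypotheses \<open>AllI\<close> has nothing to shift, so an axiom can be closed
  off by enough quantifiers to bind all its free indices, and the closure can then be instantiated
  along \<open>f\<close>.\<close>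

lemma deriv_axiom_ren:
  assumes "p \<in> T"
  shows "deriv T H (ren f p)"
proof -
  have closure: "deriv T {} ((All ^^ n) p)" for n
  proof (induction n)
    case (Suc n)
    then show ?case using AllI[of T "{}"] by simp
  qed (simp add: Ax assms)
  have inst: "deriv T {} (ren (\<lambda>i. if i < n then f i else i - n) p)" if "deriv T {} ((All ^^ n) p)"
    for n f p
    using that
  proof (induction n arbitrary: f p)
    case 0
    then show ?case by (simp add: ren_id)
  next
    case (Suc n)
    let ?g = "\<lambda>i. if i < n then f (Suc i) else i - n"
    \<comment> \<open>The induction strips the outer \<open>n\<close> quantifiers; the innermost
      one, which binds index 0 of \<open>p\<close>, goes last and receives
      \<open>f 0\<close>.\<close>
    have "deriv T {} ((All ^^ n) (All p))"
      using Suc.prems by (simp add: funpow_swap1)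
    from Suc.IH[OF this, of "\<lambda>i. f (Suc i)"] have "deriv T {} (inst (f 0) (ren (case_nat 0 (\<lambda>n. Suc (?g n))) p))"
      by (auto intro: AllE)
    then have "deriv T {} (ren (case_nat (f 0) ?g) p)" unfolding inst_ren .
    moreover have "case_nat (f 0) ?g = (\<lambda>i. if i < Suc n then f i else i - Suc n)"
      by (auto split: nat.split)
    ultimately show ?case by simp
  qed
  obtain n where n: "\<forall>i\<in>fv p. i < n" using finite_nat_set_iff_bounded finite_fv by meson
  have "deriv T {} (ren (\<lambda>i. if i < n then f i else i - n) p)"
    by (rule inst[OF closure])
  moreover have "ren (\<lambda>i. if i < n then f i else i - n) p = ren f p"
    using n by (intro ren_cong) auto
  ultimately show ?thesis by (auto intro: deriv_mono)
qed

text \<open>\<open>T\<close> is not renamed, so the axiom case rests on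
  \<open>deriv_axiom_ren\<close>; the other rules commute with renaming. This supplies the shift of
  hypotheses in \<open>deriv_cut\<close> and the change of variable in
  \<open>AllI_fresh\<close>.\<close>

lemma deriv_ren: "deriv T H p \<Longrightarrow> deriv T (ren f ` H) (ren f p)"
proof (induction arbitrary: f rule: deriv.induct)
  case (Ax p H)
  then show ?case by (rule deriv_axiom_ren)
next
  case (OrE H p q r)
  then show ?case by (auto intro: deriv.OrE)
next
  case (ImpI p H q)
  then show ?case by (auto intro: deriv.ImpI)
next
  case (ImpE H p q)
  then show ?case by (auto intro: deriv.ImpE)
next
  case (AllI H p)
  have "ren (case_nat 0 (\<lambda>n. Suc (f n))) ` lift ` H = lift ` ren f ` H"
    by (simp add: image_image ren_lift)
  then show ?case using AllI.IH[of "case_nat 0 (\<lambda>n. Suc (f n))"] by (auto intro: deriv.AllI)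
next
  case (AllE H p t)
  then show ?case by (auto simp: ren_inst intro: deriv.AllE)
next
  case (ExI H t p)
  then show ?case by (auto simp: ren_inst intro: deriv.ExI)
next
  case (ExE H p q)
  have "ren (case_nat 0 (\<lambda>n. Suc (f n))) ` lift ` H = lift ` ren f ` H"
    by (simp add: image_image ren_lift)
  then have "deriv T (insert (ren (case_nat 0 (\<lambda>n. Suc (f n))) p) (lift ` ren f ` H)) (lift (ren f q))"
    using ExE.IH(2)[of "case_nat 0 (\<lambda>n. Suc (f n))"] by (simp add: ren_lift)
  then show ?case using ExE.IH(1)[of f] by (auto intro: deriv.ExE)
next
  case (EqSubst H s t p)
  then have "deriv T (ren f ` H) (Eq (f s) (f t))" by simp
  then show ?case using EqSubst.IH(2)[of f] unfolding ren_inst by (rule deriv.EqSubst)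
next
  case (AndI H p q)
  then show ?case by (auto intro: deriv.AndI)
next
  case (AndE1 H p q)
  then show ?case by (auto intro: deriv.AndE1)
next
  case (AndE2 H p q)
  then show ?case by (auto intro: deriv.AndE2)
qed (auto intro: deriv.intros)

text \<open>Under a quantifier the given derivations from \<open>H\<close> are shifted by
  \<open>deriv_ren\<close>. The purpose is that the consequences of a set of formulas are closed
  under consequence.\<close>

lemma deriv_cut: "deriv T G p \<Longrightarrow> (\<And>q. q \<in> G \<Longrightarrow> deriv T H q) \<Longrightarrow> deriv T H p"
proof (induction arbitrary: H rule: deriv.induct)
  case (OrE G p q r)
  have "deriv T (insert p H) r" by (rule OrE.IH(2)) (auto intro: Hyp deriv_mono[OF OrE.prems])
  moreover have "deriv T (insert q H) r" by (rule OrE.IH(3)) (auto intro: Hyp deriv_mono[OF OrE.prems])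
  ultimately show ?case using OrE.IH(1)[OF OrE.prems] by (blast intro: deriv.OrE)
next
  case (ImpI p G q)
  have "deriv T (insert p H) q" by (rule ImpI.IH) (auto intro: Hyp deriv_mono[OF ImpI.prems])
  then show ?case by (rule deriv.ImpI)
next
  case (AllI G p)
  have "deriv T (lift ` H) p" by (rule AllI.IH) (auto simp: lift_def intro: deriv_ren AllI.prems)
  then show ?case by (rule deriv.AllI)
next
  case (ExE G p q)
  have "deriv T (lift ` H) r" if "r \<in> lift ` G" for r
    using that by (auto simp: lift_def intro: deriv_ren ExE.prems)
  then have "deriv T (insert p (lift ` H)) (lift q)"
    by (intro ExE.IH(2)) (auto intro: Hyp deriv_mono)
  then show ?case using ExE.IH(1)[OF ExE.prems] by (blast intro: deriv.ExE)
next
  case (ImpE G p q)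
  then show ?case by (meson deriv.ImpE)
next
  case (EqSubst G s t p)
  then show ?case by (meson deriv.EqSubst)
qed (auto intro: deriv.intros)

text \<open>Compactness, for the limit of the chain in \<open>prime_extension\<close>. A discharged
  hypothesis is removed from the finite set; under a quantifier the finite set of shifted formulas
  is pulled back along \<open>lift\<close>.\<close>

lemma deriv_finite: "deriv T H p \<Longrightarrow> \<exists>F\<subseteq>H. finite F \<and> deriv T F p"
proof (induction rule: deriv.induct)
  case (Ax p H)
  then show ?case by (auto intro: deriv.Ax)
next
  case (Hyp p H)
  then show ?case by (intro exI[of _ "{p}"]) (auto intro: deriv.Hyp)
next
  case (AndI H p q)
  then obtain A B where "A \<subseteq> H" "finite A" "deriv T A p" "B \<subseteq> H" "finite B" "deriv T B q" by auto
  then show ?case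
    by (intro exI[of _ "A \<union> B"]) (auto intro: deriv.AndI deriv_mono)
next
  case (OrE H p q r)
  then obtain A B C where *: "A \<subseteq> H" "finite A" "deriv T A (Or p q)"
    "B \<subseteq> insert p H" "finite B" "deriv T B r" "C \<subseteq> insert q H" "finite C" "deriv T C r" by auto
  let ?F = "A \<union> (B - {p}) \<union> (C - {q})"
  have "deriv T (insert p ?F) r" by (rule deriv_mono[OF *(6)]) auto
  moreover have "deriv T (insert q ?F) r" by (rule deriv_mono[OF *(9)]) auto
  moreover have "deriv T ?F (Or p q)" by (rule deriv_mono[OF *(3)]) auto
  ultimately have "deriv T ?F r" by (blast intro: deriv.OrE)
  then show ?case using * by (intro exI[of _ ?F]) auto
next
  case (ImpI p H q)
  then obtain B where *: "B \<subseteq> insert p H" "finite B" "deriv T B q" by auto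
  have "deriv T (insert p (B - {p})) q" by (rule deriv_mono[OF *(3)]) auto
  then show ?case using * by (intro exI[of _ "B - {p}"]) (auto intro: deriv.ImpI)
next
  case (ImpE H p q)
  then obtain A B where "A \<subseteq> H" "finite A" "deriv T A (Imp p q)" "B \<subseteq> H" "finite B" "deriv T B p"
    by auto
  then show ?case
    by (intro exI[of _ "A \<union> B"]) (auto intro: deriv.ImpE deriv_mono)
next
  case (AllI H p)
  then obtain F where "F \<subseteq> lift ` H" "finite F" "deriv T F p" by auto
  moreover from this obtain A where "A \<subseteq> H" "finite A" "F = lift ` A"
    by (meson finite_subset_image)
  ultimately show ?case by (auto intro: deriv.AllI)
next
  case (ExE H p q)
  then obtain A B where *: "A \<subseteq> H" "finite A" "deriv T A (Ex p)"
    "B \<subseteq> insert p (lift ` H)" "finite B" "deriv T B (lift q)" by auto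
  then have "B - {p} \<subseteq> lift ` H" "finite (B - {p})" by auto
  then obtain C where C: "C \<subseteq> H" "finite C" "B - {p} = lift ` C"
    by (meson finite_subset_image)
  have "deriv T (insert p (lift ` (A \<union> C))) (lift q)"
    by (rule deriv_mono[OF *(6)]) (use C in auto)
  moreover have "deriv T (A \<union> C) (Ex p)" by (rule deriv_mono[OF *(3)]) auto
  ultimately show ?case using * C by (intro exI[of _ "A \<union> C"]) (auto intro: deriv.ExE)
next
  case (EqSubst H s t p)
  then obtain A B where "A \<subseteq> H" "finite A" "deriv T A (Eq s t)" "B \<subseteq> H" "finite B" "deriv T B (inst s p)"
    by auto
  then show ?case
    by (intro exI[of _ "A \<union> B"]) (auto intro: deriv.EqSubst deriv_mono)
next
  case (FlsE H p)
  then show ?case by (meson deriv.FlsE)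
next
  case (AndE1 H p q)
  then show ?case by (meson deriv.AndE1)
next
  case (AndE2 H p q)
  then show ?case by (meson deriv.AndE2)
next
  case (OrI1 H p q)
  then show ?case by (meson deriv.OrI1)
next
  case (OrI2 H q p)
  then show ?case by (meson deriv.OrI2)
next
  case (AllE H p t)
  then show ?case by (meson deriv.AllE)
next
  case (ExI H t p)
  then show ?case by (meson deriv.ExI)
next
  case (EqRefl H t)
  then show ?case by (meson deriv.EqRefl empty_subsetI finite.emptyI)
qed

section \<open>Quantifier rules with a fresh variable\<close>

lemma ren_fresh:
  assumes "x \<notin> fv p"
  shows "ren (\<lambda>n. if n = x then 0 else Suc n) p = lift p"
  unfolding lift_def using assms by (intro ren_cong) auto

lemma ren_fresh_image:
  assumes "\<And>p. p \<in> H \<Longrightarrow> x \<notin> fv p"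
  shows "ren (\<lambda>n. if n = x then 0 else Suc n) ` H = lift ` H"
  using assms by (intro image_cong) (auto simp: ren_fresh)

text \<open>The renaming that moves \<open>x\<close> to index 0 undoes instantiation by a fresh
  \<open>x\<close>, and on formulas without \<open>x\<close> it acts as \<open>lift\<close>. Applied
  to a whole derivation it turns a free variable into the one bound by a quantifier rule.\<close>

lemma ren_fresh_inst:
  assumes "x \<notin> fv (All p)"
  shows "ren (\<lambda>n. if n = x then 0 else Suc n) (inst x p) = p"
proof -
  have "\<forall>n\<in>fv p. ((\<lambda>n. if n = x then 0 else Suc n) \<circ> case_nat x (\<lambda>n. n)) n = n"
    using assms by (auto split: nat.split)
  then show ?thesis unfolding inst_def ren_ren by (rule ren_id)
qed

lemma AllI_fresh:
  assumes "\<And>q. q \<in> H \<Longrightarrow> x \<notin> fv q" "x \<notin> fv (All p)" "deriv T H (inst x p)"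
  shows "deriv T H (All p)"
proof -
  have "deriv T (lift ` H) p"
    using deriv_ren[OF assms(3), of "\<lambda>n. if n = x then 0 else Suc n"]
    by (simp only: ren_fresh_inst[OF assms(2)] ren_fresh_image[OF assms(1)])
  then show ?thesis by (rule AllI)
qed

lemma ExE_fresh:
  assumes "\<And>r. r \<in> H \<Longrightarrow> x \<notin> fv r" "x \<notin> fv (Ex p)" "x \<notin> fv q"
    and "deriv T H (Ex p)" "deriv T (insert (inst x p) H) q"
  shows "deriv T H q"
proof -
  have "x \<notin> fv (All p)" using assms(2) by simp
  then have "deriv T (insert p (lift ` H)) (lift q)"
    using deriv_ren[OF assms(5), of "\<lambda>n. if n = x then 0 else Suc n"]
    by (simp only: image_insert ren_fresh_inst[OF \<open>x \<notin> fv (All p)\<close>] ren_fresh[OF assms(3)] ren_fresh_image[OF assms(1)])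
  with assms(4) show ?thesis by (rule ExE)
qed

section \<open>Prime theories\<close>

text \<open>Countability allows the stages of \<open>prime_extension\<close> to be indexed by
  natural numbers.\<close>

instance fm :: countable by countable_datatype

type_synonym world = "fm set \<times> nat set"

text \<open>A world \<open>(\<Gamma>, D)\<close> is a theory in the variables \<open>D\<close>; infinitely many variables are left for
  the worlds above it.\<close>

definition world :: "fm set \<Rightarrow> world \<Rightarrow> bool" where
  "world T w \<longleftrightarrow> infinite (- snd w) \<and> (\<forall>p\<in>fst w. fv p \<subseteq> snd w) \<and>
     (\<forall>p. fv p \<subseteq> snd w \<longrightarrow> deriv T (fst w) p \<longrightarrow> p \<in> fst w) \<and> Fls \<notin> fst w \<and>
     (\<forall>p q. Or p q \<in> fst w \<longrightarrow> p \<in> fst w \<or> q \<in> fst w) \<and>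
     (\<forall>p. Ex p \<in> fst w \<longrightarrow> (\<exists>t\<in>snd w. inst t p \<in> fst w))"

text \<open>Requiring both ends to be worlds makes the relation reflexive exactly at the worlds, so
  that \<open>world_le T w w\<close> can express that \<open>w\<close> is one.\<close>

definition world_le :: "fm set \<Rightarrow> world \<Rightarrow> world \<Rightarrow> bool" where
  "world_le T v w \<longleftrightarrow> world T v \<and> world T w \<and> fst v \<subseteq> fst w \<and> snd v \<subseteq> snd w"

lemma world_iff_deriv:
  assumes "world T w" "fv p \<subseteq> snd w"
  shows "p \<in> fst w \<longleftrightarrow> deriv T (fst w) p"
  using assms by (auto simp: world_def intro: Hyp)

text \<open>Henkin construction: \<open>H\<close> grows in countably many stages, each treating one
  formula. A derivable disjunction contributes a disjunct, a derivable existential formula an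
  instance at a new variable; by the elimination rules this can be done with \<open>q\<close>
  staying underivable.\<close>

lemma prime_extension:
  assumes H: "\<And>p. p \<in> H \<Longrightarrow> fv p \<subseteq> D" and inf: "infinite (- D)"
    and q: "fv q \<subseteq> D" "\<not> deriv T H q"
  obtains w where "world T w" "H \<subseteq> fst w" "D \<subseteq> snd w" "q \<notin> fst w"
proof -
  \<comment> \<open>The variables of \<open>E\<close> join the domain as witnesses; those of
    \<open>E'\<close> stay outside, so that the new world again leaves infinitely many variables
    free.\<close>
  obtain E E' where E: "infinite E" "infinite E'" "E \<inter> E' = {}" "E \<subseteq> - D" "E' \<subseteq> - D"
    using infinite_split[OF inf] by metis
  define D' where "D' = D \<union> E"
  have D': "D \<subseteq> D'" "E \<subseteq> D'" "infinite (- D')"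
  proof -
    have "E' \<subseteq> - D'" using E by (auto simp: D'_def)
    then show "infinite (- D')" using E(2) finite_subset by blast
  qed (auto simp: D'_def)
  \<comment> \<open>Finiteness of \<open>G - H\<close> guarantees that some variable of
    \<open>E\<close> is still fresh for \<open>G\<close> at every stage.\<close>
  define good where "good G \<longleftrightarrow> \<not> deriv T G q \<and> H \<subseteq> G \<and> finite (G - H) \<and> (\<forall>p\<in>G. fv p \<subseteq> D')" for G
  define ready where "ready G \<phi> \<longleftrightarrow> (fv \<phi> \<subseteq> D' \<and> deriv T G \<phi> \<longrightarrow>
    (\<forall>a b. \<phi> = Or a b \<longrightarrow> a \<in> G \<or> b \<in> G) \<and> (\<forall>a. \<phi> = Ex a \<longrightarrow> (\<exists>t\<in>D'. inst t a \<in> G)))" for G \<phi>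
  have step: "\<exists>G'. good G' \<and> G \<subseteq> G' \<and> (deriv T G \<phi> \<longrightarrow> ready G' \<phi>)" if G: "good G" for G \<phi>
  proof (cases "fv \<phi> \<subseteq> D' \<and> deriv T G \<phi>")
    case False
    then show ?thesis using G by (intro exI[of _ G]) (auto simp: ready_def)
  next
    case True
    note \<phi> = this
    have ins: "good (insert a G)" if "\<not> deriv T (insert a G) q" "fv a \<subseteq> D'" for a
      using that G by (auto simp: good_def insert_Diff_if)
    show ?thesis
    proof (cases \<phi>)
      case (Or a b)
      then have "\<not> deriv T (insert a G) q \<or> \<not> deriv T (insert b G) q"
        using G \<phi> by (auto simp: good_def intro: OrE)
      then obtain c where "c = a \<or> c = b" "\<not> deriv T (insert c G) q" by auto
      then show ?thesis using ins[of c] \<phi> Or by (intro exI[of _ "insert c G"]) (auto simp: ready_def)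
    next
      case (Ex a)
      have "finite (\<Union> (fv ` insert \<phi> (insert q (G - H))))" using G by (auto simp: good_def)
      then obtain x where x: "x \<in> E" "x \<notin> \<Union> (fv ` insert \<phi> (insert q (G - H)))"
        using E(1) by (meson finite_subset subsetI)
      have "x \<notin> fv r" if "r \<in> G" for r
        using that x H E by (cases "r \<in> H") auto
      then have "\<not> deriv T (insert (inst x a) G) q"
        using ExE_fresh[of G x a q T] G \<phi> x Ex by (auto simp: good_def)
      moreover have "fv (inst x a) \<subseteq> D'" using fv_inst[of x a] \<phi> Ex x D' by auto
      ultimately show ?thesis using ins[of "inst x a"] x Ex D'
        by (intro exI[of _ "insert (inst x a) G"]) (auto simp: ready_def)
    qed (use G in \<open>auto simp: ready_def\<close>)
  qed
  \<comment> \<open>The first component of \<open>prod_decode\<close> takes each value infinitely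
    often, so every formula is treated at arbitrarily late stages, in particular after it has become
    derivable.\<close>
  define \<phi> where "\<phi> n = (from_nat (fst (prod_decode n)) :: fm)" for n
  have "good H" using H q D' by (auto simp: good_def)
  obtain nxt where nxt: "\<And>G \<phi>. good G \<Longrightarrow>
      good (nxt G \<phi>) \<and> G \<subseteq> nxt G \<phi> \<and> (deriv T G \<phi> \<longrightarrow> ready (nxt G \<phi>) \<phi>)"
    using step by metis
  define G where "G = rec_nat H (\<lambda>n G. nxt G (\<phi> n))"
  have G_0: "G 0 = H" and G_Suc: "G (Suc n) = nxt (G n) (\<phi> n)" for n by (simp_all add: G_def)
  have good: "good (G n)" for n
    by (induction n) (use nxt \<open>good H\<close> in \<open>auto simp: G_0 G_Suc\<close>)
  then have G_step: "G n \<subseteq> G (Suc n)" "deriv T (G n) (\<phi> n) \<Longrightarrow> ready (G (Suc n)) (\<phi> n)" for n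
    using nxt by (auto simp: G_Suc)
  have mono: "G m \<subseteq> G n" if "m \<le> n" for m n
    using G_step(1) that by (meson lift_Suc_mono_le)
  have compact: "\<exists>n. deriv T (G n) p" if "deriv T (\<Union>n. G n) p" for p
  proof -
    obtain F where F: "F \<subseteq> (\<Union>n. G n)" "finite F" "deriv T F p" using deriv_finite[OF \<open>deriv T (\<Union>n. G n) p\<close>] by auto
    have "\<exists>n. F \<subseteq> G n" using F(2,1)
    proof (induction F)
      case (insert a F)
      then obtain n m where "F \<subseteq> G n" "a \<in> G m" by auto
      then have "insert a F \<subseteq> G (max n m)" using mono[of n "max n m"] mono[of m "max n m"] by auto
      then show ?case by blast
    qed auto
    then show ?thesis using F deriv_mono by blast
  qed
  \<comment> \<open>The stages add only disjuncts and witnesses; deductive closure is taken at the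
    end, within the variables of \<open>D'\<close>.\<close>
  define \<Gamma> where "\<Gamma> = {p. fv p \<subseteq> D' \<and> deriv T (\<Union>n. G n) p}"
  have \<Gamma>: "deriv T (\<Union>n. G n) p" if "deriv T \<Gamma> p" for p
    using that by (rule deriv_cut) (auto simp: \<Gamma>_def)
  have G\<Gamma>: "G n \<subseteq> \<Gamma>" for n using good[of n] by (auto simp: \<Gamma>_def good_def intro: Hyp)
  have notq: "\<not> deriv T (\<Union>n. G n) q" using compact[of q] good by (auto simp: good_def)
  have ready: "\<exists>n. ready (G n) p \<and> deriv T (G n) p" if p: "p \<in> \<Gamma>" for p
  proof -
    obtain n where n: "deriv T (G n) p" using p compact by (auto simp: \<Gamma>_def)
    \<comment> \<open>A stage that treats \<open>p\<close> and comes no earlier than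
      \<open>n\<close>, hence when \<open>p\<close> is already derivable.\<close>
    define m where "m = prod_encode (to_nat p, n)"
    have "n \<le> m" by (simp add: m_def le_prod_encode_2)
    then have "deriv T (G m) p" using n mono deriv_mono by blast
    moreover have "\<phi> m = p" by (simp add: \<phi>_def m_def)
    ultimately show ?thesis using G_step[of m] deriv_mono[of T "G m" p "G (Suc m)"] by auto
  qed
  have "world T (\<Gamma>, D')"
    unfolding world_def fst_conv snd_conv
  proof (intro conjI allI impI ballI)
    show "infinite (- D')" by fact
    show "fv p \<subseteq> D'" if "p \<in> \<Gamma>" for p using that by (simp add: \<Gamma>_def)
    show "p \<in> \<Gamma>" if "fv p \<subseteq> D'" "deriv T \<Gamma> p" for p using that \<Gamma> by (simp add: \<Gamma>_def)
    show "Fls \<notin> \<Gamma>" using notq by (auto simp: \<Gamma>_def intro: FlsE)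
    show "a \<in> \<Gamma> \<or> b \<in> \<Gamma>" if Or: "Or a b \<in> \<Gamma>" for a b
    proof -
      obtain n where "ready (G n) (Or a b)" "deriv T (G n) (Or a b)" using ready[OF Or] by auto
      moreover have "fv (Or a b) \<subseteq> D'" using Or unfolding \<Gamma>_def by blast
      ultimately have "a \<in> G n \<or> b \<in> G n" unfolding ready_def by blast
      then show ?thesis using G\<Gamma>[of n] by blast
    qed
    show "\<exists>t\<in>D'. inst t a \<in> \<Gamma>" if Ex: "Ex a \<in> \<Gamma>" for a
    proof -
      obtain n where "ready (G n) (Ex a)" "deriv T (G n) (Ex a)" using ready[OF Ex] by auto
      moreover have "fv (Ex a) \<subseteq> D'" using Ex unfolding \<Gamma>_def by blast
      ultimately have "\<exists>t\<in>D'. inst t a \<in> G n" unfolding ready_def by blast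
      then show ?thesis using G\<Gamma>[of n] by blast
    qed
  qed
  moreover have "H \<subseteq> \<Gamma>" using G\<Gamma>[of 0] G_0 by simp
  moreover have "q \<notin> \<Gamma>" using notq by (simp add: \<Gamma>_def)
  ultimately show thesis using that[of "(\<Gamma>, D')"] D' by auto
qed

lemma range_case_nat: "range \<rho> \<subseteq> A \<Longrightarrow> t \<in> A \<Longrightarrow> range (case_nat t \<rho>) \<subseteq> A"
  by (auto simp: image_subset_iff split: nat.split)

section \<open>Kripke models\<close>

text \<open>Elements are numbers because the canonical model consists of variables, and equality is
  a congruence \<open>E\<close> instead of identity, which spares a quotient. Reflexivity of
  \<open>\<sqsubseteq>\<close> is demanded only on its field: \<open>w \<sqsubseteq> w\<close>
  expresses that \<open>w\<close> is a world. Since \<open>M\<close> and \<open>E\<close> hold only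
  within the domain, bounded quantifiers need no mention of it.\<close>

locale kripke =
  fixes le :: "'w \<Rightarrow> 'w \<Rightarrow> bool"  (infix \<open>\<sqsubseteq>\<close> 50)
    and D :: "'w \<Rightarrow> nat set"
    and M E :: "'w \<Rightarrow> nat \<Rightarrow> nat \<Rightarrow> bool"
  assumes le_reflD: "v \<sqsubseteq> w \<Longrightarrow> v \<sqsubseteq> v \<and> w \<sqsubseteq> w"
    and le_trans: "u \<sqsubseteq> v \<Longrightarrow> v \<sqsubseteq> w \<Longrightarrow> u \<sqsubseteq> w"
    and D_mono: "v \<sqsubseteq> w \<Longrightarrow> x \<in> D v \<Longrightarrow> x \<in> D w"
    and M_mono: "v \<sqsubseteq> w \<Longrightarrow> M v x y \<Longrightarrow> M w x y"
    and E_mono: "v \<sqsubseteq> w \<Longrightarrow> E v x y \<Longrightarrow> E w x y"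
    and M_D: "M w x y \<Longrightarrow> x \<in> D w \<and> y \<in> D w"
    and E_D: "E w x y \<Longrightarrow> x \<in> D w \<and> y \<in> D w"
    and E_refl: "w \<sqsubseteq> w \<Longrightarrow> x \<in> D w \<Longrightarrow> E w x x"
    and E_sym: "E w x y \<Longrightarrow> E w y x"
    and E_trans: "E w x y \<Longrightarrow> E w y z \<Longrightarrow> E w x z"
    and M_cong_left: "E w x x' \<Longrightarrow> M w x y \<Longrightarrow> M w x' y"
    and M_cong_right: "E w y y' \<Longrightarrow> M w x y \<Longrightarrow> M w x y'"
begin

primrec forces :: "'w \<Rightarrow> (nat \<Rightarrow> nat) \<Rightarrow> fm \<Rightarrow> bool" where
  "forces w \<rho> Fls = False"
| "forces w \<rho> (Mem x y) = M w (\<rho> x) (\<rho> y)"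
| "forces w \<rho> (Eq x y) = E w (\<rho> x) (\<rho> y)"
| "forces w \<rho> (And p q) = (forces w \<rho> p \<and> forces w \<rho> q)"
| "forces w \<rho> (Or p q) = (forces w \<rho> p \<or> forces w \<rho> q)"
| "forces w \<rho> (Imp p q) = (\<forall>w'. w \<sqsubseteq> w' \<longrightarrow> forces w' \<rho> p \<longrightarrow> forces w' \<rho> q)"
| "forces w \<rho> (All p) = (\<forall>w'. w \<sqsubseteq> w' \<longrightarrow> (\<forall>t\<in>D w'. forces w' (case_nat t \<rho>) p))"
| "forces w \<rho> (Ex p) = (\<exists>t\<in>D w. forces w (case_nat t \<rho>) p)"

lemma forces_mono: "v \<sqsubseteq> w \<Longrightarrow> forces v \<rho> p \<Longrightarrow> forces w \<rho> p"
proof (induction p arbitrary: \<rho>)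
  case (Imp p q)
  then show ?case using le_trans by fastforce
next
  case (All p)
  then show ?case using le_trans by fastforce
qed (auto intro: M_mono E_mono D_mono)

lemma forces_ren: "forces w \<rho> (ren f p) = forces w (\<rho> \<circ> f) p"
proof (induction p arbitrary: w \<rho> f)
  case (All p)
  have "case_nat t \<rho> \<circ> case_nat 0 (\<lambda>n. Suc (f n)) = case_nat t (\<rho> \<circ> f)" for t
    by (auto split: nat.split)
  then show ?case by (simp only: ren.simps forces.simps All)
next
  case (Ex p)
  have "case_nat t \<rho> \<circ> case_nat 0 (\<lambda>n. Suc (f n)) = case_nat t (\<rho> \<circ> f)" for t
    by (auto split: nat.split)
  then show ?case by (simp only: ren.simps forces.simps Ex)
qed auto

text \<open>The list \<open>es\<close> gives the values of the levels, \<open>\<rho>\<close> those of the parameters.\<close>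

definition env :: "nat list \<Rightarrow> (nat \<Rightarrow> nat) \<Rightarrow> nat \<Rightarrow> nat" where
  "env es \<rho> = (\<lambda>i. if i < length es then es ! (length es - Suc i) else \<rho> (i - length es))"

text \<open>At depth \<open>length es\<close> level \<open>x\<close> denotes \<open>es ! x\<close>,
  so formulas are evaluated in their named form and a quantifier appends its value to the
  list.\<close>

definition holds :: "(nat \<Rightarrow> nat) \<Rightarrow> 'w \<Rightarrow> nat list \<Rightarrow> form \<Rightarrow> bool" where
  "holds \<rho> w es F = forces w (env es \<rho>) (F (length es))"

lemma env_Nil [simp]: "env [] \<rho> = \<rho>"
  by (simp add: env_def)

lemma env_snoc: "env (es @ [t]) \<rho> = case_nat t (env es \<rho>)"
proof
  show "env (es @ [t]) \<rho> i = case_nat t (env es \<rho>) i" for i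
    by (cases i) (auto simp: env_def nth_append)
qed

lemma range_env: "range \<rho> \<subseteq> A \<Longrightarrow> set es \<subseteq> A \<Longrightarrow> range (env es \<rho>) \<subseteq> A"
  by (auto simp: env_def subset_iff)

lemma env_level [simp]: "x < length es \<Longrightarrow> env es \<rho> (length es - Suc x) = es ! x"
  by (auto simp: env_def)

lemma forces_formula: "forces w \<rho> (formula F) = holds \<rho> w [] F"
  by (simp add: holds_def formula_def)

lemma holds_mem [simp]:
  "x < length es \<Longrightarrow> y < length es \<Longrightarrow> holds \<rho> w es (x \<^bold>\<in> y) = M w (es ! x) (es ! y)"
  by (simp add: holds_def mem_def)

lemma holds_eq [simp]:
  "x < length es \<Longrightarrow> y < length es \<Longrightarrow> holds \<rho> w es (x \<^bold>= y) = E w (es ! x) (es ! y)"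
  by (simp add: holds_def eq_def)

lemma holds_connectives [simp]:
  "holds \<rho> w es \<^bold>\<bottom> = False"
  "holds \<rho> w es (F \<^bold>\<and> G) = (holds \<rho> w es F \<and> holds \<rho> w es G)"
  "holds \<rho> w es (F \<^bold>\<or> G) = (holds \<rho> w es F \<or> holds \<rho> w es G)"
  "holds \<rho> w es (F \<^bold>\<longrightarrow> G) = (\<forall>w'. w \<sqsubseteq> w' \<longrightarrow> holds \<rho> w' es F \<longrightarrow> holds \<rho> w' es G)"
  "holds \<rho> w es (F \<^bold>\<longleftrightarrow> G) = (\<forall>w'. w \<sqsubseteq> w' \<longrightarrow> holds \<rho> w' es F = holds \<rho> w' es G)"
  by (auto simp: holds_def falsity_def conj_def disj_def imp_def iff_def)

lemma holds_all:
  "holds \<rho> w es (all F) = (\<forall>w'. w \<sqsubseteq> w' \<longrightarrow> (\<forall>t\<in>D w'. holds \<rho> w' (es @ [t]) (F (length es))))"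
  by (simp add: holds_def all_def env_snoc)

lemma holds_ex [simp]: "holds \<rho> w es (ex F) = (\<exists>t\<in>D w. holds \<rho> w (es @ [t]) (F (length es)))"
  by (simp add: holds_def ex_def env_snoc)

text \<open>The world at which the antecedent is assumed merges with the one at which the element is
  chosen, since \<open>\<sqsubseteq>\<close> is transitive and domains grow. This keeps the number
  of nested worlds small.\<close>

lemma holds_all_imp [simp]:
  "holds \<rho> w es (\<^bold>\<forall>x. F x \<^bold>\<longrightarrow> G x) = (\<forall>w'. w \<sqsubseteq> w' \<longrightarrow>
     (\<forall>t\<in>D w'. holds \<rho> w' (es @ [t]) (F (length es)) \<longrightarrow> holds \<rho> w' (es @ [t]) (G (length es))))"
  unfolding holds_all holds_connectives using le_reflD le_trans D_mono by meson

lemma holds_all_iff [simp]: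
  "holds \<rho> w es (\<^bold>\<forall>x. F x \<^bold>\<longleftrightarrow> G x) = (\<forall>w'. w \<sqsubseteq> w' \<longrightarrow>
     (\<forall>t\<in>D w'. holds \<rho> w' (es @ [t]) (F (length es)) = holds \<rho> w' (es @ [t]) (G (length es))))"
  unfolding holds_all holds_connectives using le_reflD le_trans D_mono by meson

lemma holds_all_in [simp]:
  "a < length es \<Longrightarrow> holds \<rho> w es (all_in a F) = (\<forall>w'. w \<sqsubseteq> w' \<longrightarrow>
     (\<forall>t. M w' t (es ! a) \<longrightarrow> holds \<rho> w' (es @ [t]) (F (length es))))"
  unfolding all_in_def holds_all_imp using M_D by (auto simp: nth_append)

lemma holds_ex_in [simp]:
  "a < length es \<Longrightarrow> holds \<rho> w es (ex_in a F) =
     (\<exists>t. M w t (es ! a) \<and> holds \<rho> w (es @ [t]) (F (length es)))"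
  unfolding ex_in_def holds_ex using M_D by (auto simp: nth_append)

text \<open>Index 0 of \<open>p\<close> is its first argument, whereas in an environment list index
  0 is the last entry: hence the reversal.\<close>

lemma holds_app:
  assumes "\<forall>x\<in>set xs. x < length es"
  shows "holds \<rho> w es (app p xs) = forces w (env (rev (map ((!) es) xs)) \<rho>) p"
proof -
  have "env es \<rho> (if i < length xs then length es - Suc (xs ! i) else length es + (i - length xs)) =
      env (rev (map ((!) es) xs)) \<rho> i" for i
    using assms by (auto simp: env_def[of "rev _"] rev_nth) (auto simp: env_def)
  then show ?thesis unfolding holds_def app_def forces_ren comp_def by simp
qed

lemma env_Cons_Nil: "env [x] \<rho> = case_nat x \<rho>" "env [y, x] \<rho> = case_nat x (case_nat y \<rho>)"
  using env_snoc[of "[]"] env_snoc[of "[y]"] by simp_all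

section \<open>The set-theoretic notions in a Kripke model\<close>

definition SUB :: "'w \<Rightarrow> nat \<Rightarrow> nat \<Rightarrow> bool" where
  "SUB w x y \<longleftrightarrow> (\<forall>w'. w \<sqsubseteq> w' \<longrightarrow> (\<forall>z. M w' z x \<longrightarrow> M w' z y))"

text \<open>The unordered pair, and with \<open>y = x\<close> the singleton: both elements of a
  Kuratowski pair are instances.\<close>

definition UP :: "'w \<Rightarrow> nat \<Rightarrow> nat \<Rightarrow> nat \<Rightarrow> bool" where
  "UP w v x y \<longleftrightarrow> (\<forall>w'. w \<sqsubseteq> w' \<longrightarrow> (\<forall>u\<in>D w'. M w' u v = (E w' u x \<or> E w' u y)))"

definition PAIR :: "'w \<Rightarrow> nat \<Rightarrow> nat \<Rightarrow> nat \<Rightarrow> bool" where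
  "PAIR w z x y \<longleftrightarrow> (\<forall>w'. w \<sqsubseteq> w' \<longrightarrow> (\<forall>u\<in>D w'. M w' u z = (UP w' u x x \<or> UP w' u x y)))"

definition REL :: "'w \<Rightarrow> nat \<Rightarrow> nat \<Rightarrow> nat \<Rightarrow> bool" where
  "REL w r x y \<longleftrightarrow> (\<exists>z. M w z r \<and> PAIR w z x y)"

definition EMPTY :: "'w \<Rightarrow> nat \<Rightarrow> bool" where
  "EMPTY w x \<longleftrightarrow> (\<forall>w'. w \<sqsubseteq> w' \<longrightarrow> (\<forall>z. \<not> M w' z x))"

definition SUCC :: "'w \<Rightarrow> nat \<Rightarrow> nat \<Rightarrow> bool" where
  "SUCC w y x \<longleftrightarrow> (\<forall>w'. w \<sqsubseteq> w' \<longrightarrow> (\<forall>z\<in>D w'. M w' z y = (M w' z x \<or> E w' z x)))"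

definition INDUCTIVE :: "'w \<Rightarrow> nat \<Rightarrow> bool" where
  "INDUCTIVE w b \<longleftrightarrow> (\<exists>e. M w e b \<and> EMPTY w e) \<and>
     (\<forall>w'. w \<sqsubseteq> w' \<longrightarrow> (\<forall>x. M w' x b \<longrightarrow> (\<exists>y. M w' y b \<and> SUCC w' y x)))"

definition OMEGA :: "'w \<Rightarrow> nat \<Rightarrow> bool" where
  "OMEGA w b \<longleftrightarrow> INDUCTIVE w b \<and>
     (\<forall>w'. w \<sqsubseteq> w' \<longrightarrow> (\<forall>c\<in>D w'. INDUCTIVE w' c \<longrightarrow> SUB w' b c))"

definition FUN :: "'w \<Rightarrow> nat \<Rightarrow> nat \<Rightarrow> bool" where
  "FUN w f d \<longleftrightarrow>
     (\<forall>w'. w \<sqsubseteq> w' \<longrightarrow> (\<forall>z. M w' z f \<longrightarrow> (\<exists>x. M w' x d \<and> (\<exists>y\<in>D w'. PAIR w' z x y)))) \<and>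
     (\<forall>w'. w \<sqsubseteq> w' \<longrightarrow> (\<forall>x. M w' x d \<longrightarrow> (\<exists>y\<in>D w'. REL w' f x y \<and>
        (\<forall>w''. w' \<sqsubseteq> w'' \<longrightarrow> (\<forall>y'\<in>D w''. REL w'' f x y' \<longrightarrow> E w'' y' y)))))"

definition IMG :: "'w \<Rightarrow> nat \<Rightarrow> nat \<Rightarrow> nat \<Rightarrow> bool" where
  "IMG w a f d \<longleftrightarrow> (\<forall>w'. w \<sqsubseteq> w' \<longrightarrow> (\<forall>y\<in>D w'. M w' y a = (\<exists>x. M w' x d \<and> REL w' f x y)))"

definition SEG :: "'w \<Rightarrow> nat \<Rightarrow> nat \<Rightarrow> bool" where
  "SEG w d n \<longleftrightarrow> (\<forall>w'. w \<sqsubseteq> w' \<longrightarrow> (\<forall>k\<in>D w'. M w' k d = (\<exists>m. M w' m n \<and> SUCC w' k m)))"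

definition FIN :: "'w \<Rightarrow> nat \<Rightarrow> bool" where
  "FIN w a \<longleftrightarrow> (\<exists>b\<in>D w. OMEGA w b \<and> (\<exists>n. M w n b \<and> (\<exists>d\<in>D w. SEG w d n \<and>
     (\<exists>f\<in>D w. FUN w f d \<and> IMG w a f d))))"

lemma UP_mono: "v \<sqsubseteq> w \<Longrightarrow> UP v c x y \<Longrightarrow> UP w c x y"
  unfolding UP_def using le_trans by blast

lemma PAIR_mono: "v \<sqsubseteq> w \<Longrightarrow> PAIR v z x y \<Longrightarrow> PAIR w z x y"
  unfolding PAIR_def using le_trans by blast

lemma SUB_mono: "v \<sqsubseteq> w \<Longrightarrow> SUB v x y \<Longrightarrow> SUB w x y"
  unfolding SUB_def using le_trans by blast

lemma SUCC_mono: "v \<sqsubseteq> w \<Longrightarrow> SUCC v x y \<Longrightarrow> SUCC w x y"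
  unfolding SUCC_def using le_trans by blast

lemma EMPTY_mono: "v \<sqsubseteq> w \<Longrightarrow> EMPTY v x \<Longrightarrow> EMPTY w x"
  unfolding EMPTY_def using le_trans by blast

lemma holds_subset [simp]:
  "x < length es \<Longrightarrow> y < length es \<Longrightarrow> holds \<rho> w es (x \<^bold>\<subseteq> y) = SUB w (es ! x) (es ! y)"
  using M_D by (auto simp: subset_def SUB_def nth_append)

lemma holds_all_sub [simp]:
  "a < length es \<Longrightarrow> holds \<rho> w es (all_sub a F) = (\<forall>w'. w \<sqsubseteq> w' \<longrightarrow>
     (\<forall>t\<in>D w'. SUB w' t (es ! a) \<longrightarrow> holds \<rho> w' (es @ [t]) (F (length es))))"
  by (simp add: all_sub_def nth_append)

lemma holds_is_pair [simp]:
  "z < length es \<Longrightarrow> x < length es \<Longrightarrow> y < length es \<Longrightarrow>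
   holds \<rho> w es (is_pair z x y) = PAIR w (es ! z) (es ! x) (es ! y)"
  by (simp add: PAIR_def UP_def is_pair_def nth_append)

lemma holds_related [simp]:
  "r < length es \<Longrightarrow> x < length es \<Longrightarrow> y < length es \<Longrightarrow>
   holds \<rho> w es (related r x y) = REL w (es ! r) (es ! x) (es ! y)"
  by (simp add: REL_def related_def nth_append)

lemma holds_is_empty [simp]: "x < length es \<Longrightarrow> holds \<rho> w es (is_empty x) = EMPTY w (es ! x)"
  using M_D by (simp add: EMPTY_def is_empty_def nth_append) blast

lemma holds_is_succ [simp]:
  "x < length es \<Longrightarrow> y < length es \<Longrightarrow> holds \<rho> w es (is_succ y x) = SUCC w (es ! y) (es ! x)"
  by (simp add: SUCC_def is_succ_def nth_append)

lemma holds_is_inductive [simp]: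
  "b < length es \<Longrightarrow> holds \<rho> w es (is_inductive b) = INDUCTIVE w (es ! b)"
  by (simp add: INDUCTIVE_def is_inductive_def nth_append)

lemma holds_is_omega [simp]: "b < length es \<Longrightarrow> holds \<rho> w es (is_omega b) = OMEGA w (es ! b)"
  by (simp add: OMEGA_def is_omega_def nth_append)

lemma holds_is_function_on [simp]:
  "f < length es \<Longrightarrow> d < length es \<Longrightarrow>
   holds \<rho> w es (is_function_on f d) = FUN w (es ! f) (es ! d)"
  by (simp add: FUN_def is_function_on_def nth_append)

lemma holds_is_image [simp]:
  "a < length es \<Longrightarrow> f < length es \<Longrightarrow> d < length es \<Longrightarrow>
   holds \<rho> w es (is_image a f d) = IMG w (es ! a) (es ! f) (es ! d)"
  by (simp add: IMG_def is_image_def nth_append)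

lemma holds_is_initial_segment [simp]:
  "d < length es \<Longrightarrow> n < length es \<Longrightarrow>
   holds \<rho> w es (is_initial_segment d n) = SEG w (es ! d) (es ! n)"
  by (simp add: SEG_def is_initial_segment_def nth_append)

lemma holds_is_finite [simp]: "a < length es \<Longrightarrow> holds \<rho> w es (is_finite a) = FIN w (es ! a)"
  by (simp add: FIN_def is_finite_def nth_append)

end

section \<open>The canonical model\<close>

text \<open>The conjunct \<open>world T w\<close> empties the relation off the worlds, so that
  related variables lie in the domain for every \<open>w\<close>, as \<open>kripke\<close>
  demands.\<close>

definition canonical_mem :: "fm set \<Rightarrow> world \<Rightarrow> nat \<Rightarrow> nat \<Rightarrow> bool" where
  "canonical_mem T w x y \<longleftrightarrow> world T w \<and> Mem x y \<in> fst w"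

definition canonical_eq :: "fm set \<Rightarrow> world \<Rightarrow> nat \<Rightarrow> nat \<Rightarrow> bool" where
  "canonical_eq T w x y \<longleftrightarrow> world T w \<and> Eq x y \<in> fst w"

lemma world_fv: "world T w \<Longrightarrow> p \<in> fst w \<Longrightarrow> fv p \<subseteq> snd w"
  by (simp add: world_def)

lemma world_subst:
  assumes w: "world T w" and "Eq s t \<in> fst w" "inst s p \<in> fst w" and "fv (inst t p) \<subseteq> snd w"
  shows "inst t p \<in> fst w"
  using assms by (meson EqSubst Hyp world_iff_deriv)

text \<open>The laws of equality come from \<open>EqSubst\<close>, applied to a template in which
  index 0 marks the place to be replaced, such as \<open>Eq 0 (Suc x)\<close> for symmetry.\<close>

interpretation canonical: kripke "world_le T" snd "canonical_mem T" "canonical_eq T" for T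
proof
  fix u v w :: world and x x' y y' z :: nat
  note [simp] = world_le_def canonical_mem_def canonical_eq_def
  show "world_le T v v \<and> world_le T w w" if "world_le T v w" using that by auto
  show "world_le T u w" if "world_le T u v" "world_le T v w" using that by auto
  show "x \<in> snd w" if "world_le T v w" "x \<in> snd v" using that by auto
  show "canonical_mem T w x y" if "world_le T v w" "canonical_mem T v x y" using that by auto
  show "canonical_eq T w x y" if "world_le T v w" "canonical_eq T v x y" using that by auto
  show "x \<in> snd w \<and> y \<in> snd w" if "canonical_mem T w x y" using that world_fv by fastforce
  show *: "x \<in> snd w \<and> y \<in> snd w" if "canonical_eq T w x y" for x y w using that world_fv by fastforce
  show "canonical_eq T w x x" if "world_le T w w" "x \<in> snd w"
    using that EqRefl by (auto simp: world_iff_deriv)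
  show sym: "canonical_eq T w y x" if "canonical_eq T w x y" for x y
    using that *[OF that] world_subst[of T w x y "Eq 0 (Suc x)"] EqRefl
    by (auto simp: inst_def world_iff_deriv)
  show "canonical_eq T w x z" if "canonical_eq T w x y" "canonical_eq T w y z"
    using that *[OF that(1)] *[OF that(2)] world_subst[of T w y z "Eq (Suc x) 0"] by (auto simp: inst_def)
  show "canonical_mem T w x' y" if "canonical_eq T w x x'" "canonical_mem T w x y"
    using that *[OF that(1)] world_subst[of T w x x' "Mem 0 (Suc y)"] world_fv[of T w "Mem x y"]
    by (auto simp: inst_def)
  show "canonical_mem T w x y'" if "canonical_eq T w y y'" "canonical_mem T w x y"
    using that *[OF that(1)] world_subst[of T w y y' "Mem (Suc x) 0"] world_fv[of T w "Mem x y"]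
    by (auto simp: inst_def)
qed

lemma fv_ren_subset: "range \<rho> \<subseteq> A \<Longrightarrow> fv (ren \<rho> p) \<subseteq> A"
  by (auto simp: fv_ren)

lemma world_le_range: "world_le T v w \<Longrightarrow> range \<rho> \<subseteq> snd v \<Longrightarrow> range \<rho> \<subseteq> snd w"
  unfolding world_le_def by blast

text \<open>Primeness and witnesses settle disjunction and existence at \<open>w\<close> itself.
  Implication and universal quantification look at later worlds: if such a formula is missing from
  \<open>w\<close>, it is underivable there, and \<open>prime_extension\<close> yields a world above
  \<open>w\<close> that refutes it.\<close>

lemma truth:
  "world T w \<Longrightarrow> range \<rho> \<subseteq> snd w \<Longrightarrow> canonical.forces T w \<rho> p \<longleftrightarrow> ren \<rho> p \<in> fst w"
proof (induction p arbitrary: w \<rho>)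
  case Fls
  then show ?case by (simp add: world_def)
next
  case (Mem x y)
  then show ?case unfolding canonical.forces.simps by (simp add: canonical_mem_def)
next
  case (Eq x y)
  then show ?case unfolding canonical.forces.simps by (simp add: canonical_eq_def)
next
  case (And p q)
  note iff = world_iff_deriv[OF And.prems(1) fv_ren_subset[OF And.prems(2)]]
  show ?case
    unfolding canonical.forces.simps And.IH[OF And.prems] iff
    by (auto intro: AndI AndE1 AndE2)
next
  case (Or p q)
  note iff = world_iff_deriv[OF Or.prems(1) fv_ren_subset[OF Or.prems(2)]]
  have "ren \<rho> (Or p q) \<in> fst w \<Longrightarrow> ren \<rho> p \<in> fst w \<or> ren \<rho> q \<in> fst w"
    using Or.prems(1) by (simp add: world_def)
  moreover have "ren \<rho> p \<in> fst w \<or> ren \<rho> q \<in> fst w \<Longrightarrow> ren \<rho> (Or p q) \<in> fst w"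
    unfolding iff by (auto intro: OrI1 OrI2)
  ultimately show ?case
    unfolding canonical.forces.simps Or.IH[OF Or.prems] by blast
next
  case (Imp p q)
  note iff = world_iff_deriv[OF _ fv_ren_subset]
  show ?case
  proof
    assume Imp: "ren \<rho> (Imp p q) \<in> fst w"
    show "canonical.forces T w \<rho> (Imp p q)"
      unfolding canonical.forces.simps
    proof (intro allI impI)
      fix w' assume w': "world_le T w w'" "canonical.forces T w' \<rho> p"
      then have *: "world T w'" "range \<rho> \<subseteq> snd w'" "ren \<rho> (Imp p q) \<in> fst w'"
        using Imp Imp.prems by (auto simp: world_le_def)
      then have "ren \<rho> p \<in> fst w'" using w' Imp.IH(1) by blast
      then have "deriv T (fst w') (ren \<rho> p)" "deriv T (fst w') (Imp (ren \<rho> p) (ren \<rho> q))"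
        using *(3) by (auto intro: Hyp)
      then have "ren \<rho> q \<in> fst w'" unfolding iff[OF *(1,2)] by (blast intro: ImpE)
      then show "canonical.forces T w' \<rho> q" using Imp.IH(2) * by blast
    qed
  next
    assume Imp: "canonical.forces T w \<rho> (Imp p q)"
    show "ren \<rho> (Imp p q) \<in> fst w"
    proof (rule ccontr)
      assume "ren \<rho> (Imp p q) \<notin> fst w"
      then have "\<not> deriv T (insert (ren \<rho> p) (fst w)) (ren \<rho> q)"
        using iff[OF Imp.prems, of "Imp p q"] by (auto intro: ImpI)
      moreover have "infinite (- snd w)" using Imp.prems(1) by (simp add: world_def)
      moreover have "fv r \<subseteq> snd w" if "r \<in> insert (ren \<rho> p) (fst w)" for r
        using that fv_ren_subset[OF Imp.prems(2)] world_fv[OF Imp.prems(1)] by blast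
      ultimately obtain w' where w': "world T w'" "insert (ren \<rho> p) (fst w) \<subseteq> fst w'"
        "snd w \<subseteq> snd w'" "ren \<rho> q \<notin> fst w'"
        using prime_extension fv_ren_subset[OF Imp.prems(2)] by metis
      then have "world_le T w w'" "range \<rho> \<subseteq> snd w'" using Imp.prems by (auto simp: world_le_def)
      then show False using Imp Imp.IH[OF w'(1)] w' unfolding canonical.forces.simps by blast
    qed
  qed
next
  case (All p)
  note iff = world_iff_deriv[OF _ fv_ren_subset]
  show ?case
  proof
    assume All: "ren \<rho> (All p) \<in> fst w"
    show "canonical.forces T w \<rho> (All p)"
      unfolding canonical.forces.simps
    proof (intro allI impI ballI)
      fix w' t assume w': "world_le T w w'" "t \<in> snd w'"
      then have *: "world T w'" "range (case_nat t \<rho>) \<subseteq> snd w'"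
        using range_case_nat[OF world_le_range] All.prems w' by (auto simp: world_le_def)
      have "ren \<rho> (All p) \<in> fst w'" using All w' by (auto simp: world_le_def)
      then have "deriv T (fst w') (inst t (ren (case_nat 0 (\<lambda>n. Suc (\<rho> n))) p))"
        by (auto intro: AllE Hyp)
      then have "ren (case_nat t \<rho>) p \<in> fst w'"
        unfolding inst_ren iff[OF *(1,2)] .
      then show "canonical.forces T w' (case_nat t \<rho>) p" using All.IH * by blast
    qed
  next
    assume All: "canonical.forces T w \<rho> (All p)"
    show "ren \<rho> (All p) \<in> fst w"
    proof (rule ccontr)
      assume notin: "ren \<rho> (All p) \<notin> fst w"
      \<comment> \<open>A variable outside the domain is fresh for the whole theory, so an
        underivable universal formula has an underivable instance at \<open>x\<close>. The refuting
        world is built over the domain enlarged by \<open>x\<close>.\<close>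
      obtain x where x: "x \<notin> snd w"
        using All.prems(1) unfolding world_def by (metis ComplD finite.emptyI subsetI subset_empty)
      have "x \<notin> fv q" if "q \<in> fst w" for q using that x All.prems(1) world_fv by blast
      moreover have "x \<notin> fv (ren \<rho> (All p))" using x fv_ren_subset[OF All.prems(2)] by blast
      ultimately have nd: "\<not> deriv T (fst w) (ren (case_nat x \<rho>) p)"
        using AllI_fresh[of "fst w" x "ren (case_nat 0 (\<lambda>n. Suc (\<rho> n))) p" T] notin iff[OF All.prems, of "All p"]
        unfolding inst_ren by auto
      have inf: "infinite (- insert x (snd w))"
        using All.prems(1) unfolding world_def Compl_insert by simp
      have "range (case_nat x \<rho>) \<subseteq> insert x (snd w)"
        using All.prems(2) by (intro range_case_nat) blast+
      from prime_extension[OF _ inf fv_ren_subset[OF this] nd]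
      obtain w' where w': "world T w'" "fst w \<subseteq> fst w'" "insert x (snd w) \<subseteq> snd w'"
        "ren (case_nat x \<rho>) p \<notin> fst w'"
        using world_fv[OF All.prems(1)] by blast
      then have "world_le T w w'" using All.prems(1) by (simp add: world_le_def)
      moreover from this have "range (case_nat x \<rho>) \<subseteq> snd w'"
        using range_case_nat[OF world_le_range] All.prems(2) w'(3) by simp
      ultimately show False using All All.IH[of w' "case_nat x \<rho>"] w' unfolding canonical.forces.simps by blast
    qed
  qed
next
  case (Ex p)
  note iff = world_iff_deriv[OF Ex.prems(1) fv_ren_subset]
  have "ren \<rho> (Ex p) \<in> fst w \<longleftrightarrow> (\<exists>t\<in>snd w. ren (case_nat t \<rho>) p \<in> fst w)"
  proof
    assume "ren \<rho> (Ex p) \<in> fst w"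
    then have "\<exists>t\<in>snd w. inst t (ren (case_nat 0 (\<lambda>n. Suc (\<rho> n))) p) \<in> fst w"
      using Ex.prems(1) by (simp add: world_def)
    then show "\<exists>t\<in>snd w. ren (case_nat t \<rho>) p \<in> fst w" unfolding inst_ren .
  next
    assume "\<exists>t\<in>snd w. ren (case_nat t \<rho>) p \<in> fst w"
    then obtain t where "deriv T (fst w) (inst t (ren (case_nat 0 (\<lambda>n. Suc (\<rho> n))) p))"
      unfolding inst_ren by (auto intro: Hyp)
    then show "ren \<rho> (Ex p) \<in> fst w" unfolding iff[OF Ex.prems(2)] by (auto intro: ExI)
  qed
  moreover have "canonical.forces T w (case_nat t \<rho>) p \<longleftrightarrow> ren (case_nat t \<rho>) p \<in> fst w" if "t \<in> snd w" for t
    using Ex.prems that by (intro Ex.IH range_case_nat)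
  ultimately show ?case by auto
qed

lemma canonical_axiom:
  assumes "p \<in> T" "world T w" "range \<rho> \<subseteq> snd w"
  shows "canonical.forces T w \<rho> p"
  unfolding truth[OF assms(2,3)] world_iff_deriv[OF assms(2) fv_ren_subset[OF assms(3)]]
  by (rule deriv_axiom_ren[OF assms(1)])

theorem completeness:
  assumes "\<And>w \<rho>. world T w \<Longrightarrow> range \<rho> \<subseteq> snd w \<Longrightarrow> canonical.forces T w \<rho> p"
  shows "T \<turnstile> p"
proof (rule ccontr)
  assume "\<not> T \<turnstile> p"
  then have np: "\<not> deriv T {} p" by (simp add: provable_def)
  \<comment> \<open>Index 0 is added so that the domain is inhabited: \<open>\<rho>\<close> sends
    there every index that is not free in \<open>p\<close>.\<close>
  have inf: "infinite (- insert 0 (fv p))"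
    unfolding Compl_eq_Diff_UNIV by (intro Diff_infinite_finite) auto
  obtain w where w: "world T w" "insert 0 (fv p) \<subseteq> snd w" "p \<notin> fst w"
    by (rule prime_extension[OF _ inf _ np]) auto
  define \<rho> where "\<rho> i = (if i \<in> fv p then i else 0)" for i
  have "ren \<rho> p = p" by (rule ren_id) (simp add: \<rho>_def)
  moreover have "range \<rho> \<subseteq> snd w" using w(2) by (auto simp: \<rho>_def)
  ultimately show False using assms[of w \<rho>] truth[of T w \<rho> p] w by simp
qed

section \<open>Consequences of CZF in a Kripke model\<close>

text \<open>Forcing under every environment covers the parameters of the axiom schemes.\<close>

locale czf_model = kripke +
  assumes CZF: "p \<in> CZF \<Longrightarrow> w \<sqsubseteq> w \<Longrightarrow> range \<rho> \<subseteq> D w \<Longrightarrow> forces w \<rho> p"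
begin

lemma extensionality:
  assumes w: "w \<sqsubseteq> w" and D: "a \<in> D w" "b \<in> D w"
    and eq: "\<And>w' x. w \<sqsubseteq> w' \<Longrightarrow> M w' x a = M w' x b"
  shows "E w a b"
proof -
  \<comment> \<open>The axiom is closed, so any environment into \<open>D w\<close> will do.\<close>
  have "forces w (\<lambda>_. a) (formula (\<^bold>\<forall>a b. (\<^bold>\<forall>x. x \<^bold>\<in> a \<^bold>\<longleftrightarrow> x \<^bold>\<in> b) \<^bold>\<longrightarrow> a \<^bold>= b))"
    by (rule CZF) (use w D in \<open>auto intro: CZF.intros\<close>)
  then have "\<And>v x u y. w \<sqsubseteq> v \<Longrightarrow> x \<in> D v \<Longrightarrow> v \<sqsubseteq> u \<Longrightarrow> y \<in> D u \<Longrightarrow>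
      (\<forall>w'. u \<sqsubseteq> w' \<longrightarrow> (\<forall>t\<in>D w'. M w' t x = M w' t y)) \<Longrightarrow> E u x y"
    by (simp add: forces_formula holds_all[of _ _ "[]"])
  from this[OF w D(1) w D(2)] eq show ?thesis by blast
qed

lemma pairing:
  assumes w: "w \<sqsubseteq> w" and D: "a \<in> D w" "b \<in> D w"
  obtains c where "c \<in> D w" "UP w c a b"
proof -
  have "forces w (\<lambda>_. a) (formula (\<^bold>\<forall>a b. \<^bold>\<exists>c. \<^bold>\<forall>x. x \<^bold>\<in> c \<^bold>\<longleftrightarrow> x \<^bold>= a \<^bold>\<or> x \<^bold>= b))"
    by (rule CZF) (use w D in \<open>auto intro: CZF.intros\<close>)
  then have "\<And>v x u y. w \<sqsubseteq> v \<Longrightarrow> x \<in> D v \<Longrightarrow> v \<sqsubseteq> u \<Longrightarrow> y \<in> D u \<Longrightarrow> \<exists>c\<in>D u. UP u c x y"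
    by (simp add: forces_formula UP_def holds_all[of _ _ "[]"] holds_all[of _ _ "[_]"])
  from this[OF w D(1) w D(2)] that show ?thesis by blast
qed

lemma union:
  assumes w: "w \<sqsubseteq> w" and D: "a \<in> D w"
  obtains c where "c \<in> D w" "\<And>w' x. w \<sqsubseteq> w' \<Longrightarrow> M w' x c = (\<exists>y. M w' y a \<and> M w' x y)"
proof -
  have "forces w (\<lambda>_. a) (formula (\<^bold>\<forall>a. \<^bold>\<exists>c. \<^bold>\<forall>x. x \<^bold>\<in> c \<^bold>\<longleftrightarrow> (\<^bold>\<exists>y\<^bold>\<in>a. x \<^bold>\<in> y)))"
    by (rule CZF) (use w D in \<open>auto intro: CZF.intros\<close>)
  then have "\<exists>c\<in>D w. \<forall>w'. w \<sqsubseteq> w' \<longrightarrow> (\<forall>t\<in>D w'. M w' t c = (\<exists>y. M w' y a \<and> M w' t y))"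
    using w D by (simp add: forces_formula holds_all[of _ _ "[]"])
  with that M_D show ?thesis by meson
qed

text \<open>The axiom has to be evaluated under some environment into the domain; \<open>a\<close>
  provides one.\<close>

lemma infinity:
  assumes w: "w \<sqsubseteq> w" and D: "a \<in> D w"
  obtains b where "b \<in> D w" "OMEGA w b"
proof -
  have "forces w (\<lambda>_. a) (formula (\<^bold>\<exists>w. is_omega w))"
    by (rule CZF) (use w D in \<open>auto intro: CZF.intros\<close>)
  then have "\<exists>b\<in>D w. OMEGA w b" by (simp add: forces_formula)
  with that show ?thesis by blast
qed

text \<open>Parameters enter through the environment \<open>env es \<rho>\<close>, and
  \<open>F\<close> refers to them by their levels in \<open>es\<close>. At depth
  \<open>Suc (length es)\<close> the last level has index 0, which is where
  \<open>app ?p [x]\<close> puts its argument.\<close>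

lemma separation:
  assumes w: "w \<sqsubseteq> w" and D: "a \<in> D w" "set es \<subseteq> D w" "range \<rho> \<subseteq> D w"
    and bounded: "bounded (F (Suc (length es)))"
  obtains b where "b \<in> D w"
    "\<And>w' x. w \<sqsubseteq> w' \<Longrightarrow> M w' x b = (M w' x a \<and> holds \<rho> w' (es @ [x]) F)"
proof -
  let ?p = "F (Suc (length es))"
  have "forces w (env es \<rho>) (formula (\<^bold>\<forall>a. \<^bold>\<exists>b. \<^bold>\<forall>x. x \<^bold>\<in> b \<^bold>\<longleftrightarrow> x \<^bold>\<in> a \<^bold>\<and> app ?p [x]))"
    by (rule CZF) (use w D range_env bounded in \<open>auto intro: CZF.intros\<close>)
  then have "\<exists>b\<in>D w. \<forall>w'. w \<sqsubseteq> w' \<longrightarrow>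
      (\<forall>t\<in>D w'. M w' t b = (M w' t a \<and> forces w' (case_nat t (env es \<rho>)) ?p))"
    using w D by (simp add: forces_formula holds_all[of _ _ "[]"] holds_app env_Cons_Nil)
  moreover have "forces w' (case_nat t (env es \<rho>)) ?p = holds \<rho> w' (es @ [t]) F" for w' t
    by (simp add: holds_def env_snoc)
  ultimately show thesis using that M_D by meson
qed

text \<open>In \<open>app ?p [x, y]\<close> the argument \<open>x\<close> has index 0 and is
  therefore the last level: this is why the value \<open>y\<close> precedes \<open>x\<close> in
  \<open>es @ [y, x]\<close>.\<close>

lemma collection:
  assumes w: "w \<sqsubseteq> w" and D: "a \<in> D w" "set es \<subseteq> D w" "range \<rho> \<subseteq> D w"
    and total: "\<And>w' x. w \<sqsubseteq> w' \<Longrightarrow> M w' x a \<Longrightarrow> \<exists>y\<in>D w'. holds \<rho> w' (es @ [y, x]) F"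
  obtains b where "b \<in> D w"
    "\<And>w' x. w \<sqsubseteq> w' \<Longrightarrow> M w' x a \<Longrightarrow> \<exists>y. M w' y b \<and> holds \<rho> w' (es @ [y, x]) F"
    "\<And>w' y. w \<sqsubseteq> w' \<Longrightarrow> M w' y b \<Longrightarrow> \<exists>x. M w' x a \<and> holds \<rho> w' (es @ [y, x]) F"
proof -
  let ?p = "F (Suc (Suc (length es)))"
  have "forces w (env es \<rho>) (formula (\<^bold>\<forall>a. (\<^bold>\<forall>x\<^bold>\<in>a. \<^bold>\<exists>y. app ?p [x, y]) \<^bold>\<longrightarrow>
       (\<^bold>\<exists>b. (\<^bold>\<forall>x\<^bold>\<in>a. \<^bold>\<exists>y\<^bold>\<in>b. app ?p [x, y]) \<^bold>\<and> (\<^bold>\<forall>y\<^bold>\<in>b. \<^bold>\<exists>x\<^bold>\<in>a. app ?p [x, y]))))"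
    by (rule CZF) (use w D range_env in \<open>auto intro: CZF.intros\<close>)
  moreover have eq: "forces w' (case_nat x (case_nat y (env es \<rho>))) ?p = holds \<rho> w' (es @ [y, x]) F" for w' x y
    using env_snoc[of "es @ [y]" x] by (simp add: holds_def env_snoc)
  ultimately have "\<And>v. w \<sqsubseteq> v \<Longrightarrow>
      (\<forall>w' x. v \<sqsubseteq> w' \<longrightarrow> M w' x a \<longrightarrow> (\<exists>y\<in>D w'. holds \<rho> w' (es @ [y, x]) F)) \<Longrightarrow>
      (\<exists>b\<in>D v. (\<forall>w' x. v \<sqsubseteq> w' \<longrightarrow> M w' x a \<longrightarrow> (\<exists>y. M w' y b \<and> holds \<rho> w' (es @ [y, x]) F)) \<and>
        (\<forall>w' y. v \<sqsubseteq> w' \<longrightarrow> M w' y b \<longrightarrow> (\<exists>x. M w' x a \<and> holds \<rho> w' (es @ [y, x]) F)))"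
    using D_mono[OF _ D(1)] by (simp add: forces_formula holds_app env_Cons_Nil)
  from this[OF w] total obtain b where "b \<in> D w"
    "\<forall>w' x. w \<sqsubseteq> w' \<longrightarrow> M w' x a \<longrightarrow> (\<exists>y. M w' y b \<and> holds \<rho> w' (es @ [y, x]) F)"
    "\<forall>w' y. w \<sqsubseteq> w' \<longrightarrow> M w' y b \<longrightarrow> (\<exists>x. M w' x a \<and> holds \<rho> w' (es @ [y, x]) F)"
    by blast
  then show thesis by (intro that) blast+
qed

section \<open>Unordered and ordered pairs\<close>

lemma SUB_D: "SUB w x y \<Longrightarrow> w \<sqsubseteq> w' \<Longrightarrow> M w' z x \<Longrightarrow> M w' z y"
  unfolding SUB_def by blast

lemma M_cong: "E w x x' \<Longrightarrow> E w y y' \<Longrightarrow> M w x y = M w x' y'"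
  using M_cong_left M_cong_right E_sym by meson

lemma UP_iff: "UP w c x y \<Longrightarrow> w \<sqsubseteq> w' \<Longrightarrow> M w' u c = (E w' u x \<or> E w' u y)"
  unfolding UP_def using M_D E_D by blast

lemma UP_in:
  assumes "UP w c x y" "w \<sqsubseteq> w"
  shows "x \<in> D w \<Longrightarrow> M w x c" "y \<in> D w \<Longrightarrow> M w y c"
  using UP_iff[OF assms] E_refl assms(2) by blast+

lemma UP_cong:
  assumes "UP w c x y" "E w c c'" "E w x x'" "E w y y'"
  shows "UP w c' x' y'"
  unfolding UP_def
proof (intro allI impI ballI)
  fix w' u assume w': "w \<sqsubseteq> w'" "u \<in> D w'"
  then have e: "E w' c c'" "E w' x x'" "E w' y y'" using assms E_mono by blast+
  have "E w' u u" using w' le_reflD E_refl by blast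
  then have "M w' u c' = M w' u c" using e M_cong by blast
  also have "\<dots> = (E w' u x \<or> E w' u y)" using UP_iff assms(1) w' by blast
  also have "\<dots> = (E w' u x' \<or> E w' u y')" using e E_sym E_trans by blast
  finally show "M w' u c' = (E w' u x' \<or> E w' u y')" .
qed

lemma UP_unique:
  assumes "w \<sqsubseteq> w" "UP w c x y" "UP w c' x y" "c \<in> D w" "c' \<in> D w"
  shows "E w c c'"
  by (rule extensionality) (use assms UP_iff in auto)

lemma PAIR_iff:
  assumes "PAIR w z x y" "w \<sqsubseteq> w'"
  shows "M w' u z \<longleftrightarrow> u \<in> D w' \<and> (UP w' u x x \<or> UP w' u x y)"
  using assms unfolding PAIR_def using M_D by blast

lemma PAIR_cong:
  assumes "PAIR w z x y" "E w z z'" "E w x x'" "E w y y'"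
  shows "PAIR w z' x' y'"
  unfolding PAIR_def
proof (intro allI impI ballI)
  fix w' u assume w': "w \<sqsubseteq> w'" "u \<in> D w'"
  then have e: "E w' z z'" "E w' x x'" "E w' y y'" using assms E_mono by blast+
  have u: "E w' u u" using w' le_reflD E_refl by blast
  then have "M w' u z' = M w' u z" using e M_cong by blast
  also have "\<dots> = (UP w' u x x \<or> UP w' u x y)" using PAIR_iff assms(1) w' by blast
  also have "\<dots> = (UP w' u x' x' \<or> UP w' u x' y')" using e u UP_cong E_sym by meson
  finally show "M w' u z' = (UP w' u x' x' \<or> UP w' u x' y')" .
qed

lemma PAIR_exists:
  assumes w: "w \<sqsubseteq> w" and D: "x \<in> D w" "y \<in> D w"
  obtains z where "z \<in> D w" "PAIR w z x y"
proof -
  obtain s where s: "s \<in> D w" "UP w s x x" using pairing[OF w D(1) D(1)] .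
  obtain t where t: "t \<in> D w" "UP w t x y" using pairing[OF w D] .
  obtain z where z: "z \<in> D w" "UP w z s t" using pairing[OF w s(1) t(1)] .
  have "PAIR w z x y"
    unfolding PAIR_def
  proof (intro allI impI ballI)
    fix w' u assume w': "w \<sqsubseteq> w'" "u \<in> D w'"
    have w'': "w' \<sqsubseteq> w'" using w' le_reflD by blast
    have s': "s \<in> D w'" "UP w' s x x" and t': "t \<in> D w'" "UP w' t x y"
      using s t w' D_mono UP_mono by blast+
    have xy: "E w' x x" "E w' y y" using D w' D_mono E_refl w'' by blast+
    \<comment> \<open>Unordered pairs are unique up to equality, so being equal to \<open>s\<close>
      or \<open>t\<close> is the same as having the shape that \<open>PAIR\<close> asks for.\<close>
    have "E w' u s \<longleftrightarrow> UP w' u x x" "E w' u t \<longleftrightarrow> UP w' u x y"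
      using UP_unique[OF w''] UP_cong[OF s'(2)] UP_cong[OF t'(2)] E_sym s' t' w' xy by blast+
    then show "M w' u z = (UP w' u x x \<or> UP w' u x y)" using UP_iff[OF z(2) w'(1)] by simp
  qed
  with z that show thesis by blast
qed

text \<open>For the second components, \<open>y\<close> equals \<open>x'\<close> or
  \<open>y'\<close>, and \<open>y'\<close> equals \<open>x\<close> or \<open>y\<close>. In the only
  case that is not immediate, \<open>y = x'\<close> and \<open>y' = x\<close>, and then
  \<open>x = x'\<close> closes the chain.\<close>

lemma PAIR_inject:
  assumes w: "w \<sqsubseteq> w" and D: "x \<in> D w" "y \<in> D w" "x' \<in> D w" "y' \<in> D w"
    and "PAIR w z x y" "PAIR w z x' y'"
  shows "E w x x'" "E w y y'"
proof -
  have *: "E w x x' \<and> (E w y x' \<or> E w y y')"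
    if D: "x \<in> D w" "y \<in> D w" "x' \<in> D w" "y' \<in> D w" and P: "PAIR w z x y" "PAIR w z x' y'"
    for x y x' y'
  proof
    obtain s where s: "s \<in> D w" "UP w s x x" using pairing[OF w D(1) D(1)] .
    then have "UP w s x' x' \<or> UP w s x' y'" using PAIR_iff[OF P(1) w] PAIR_iff[OF P(2) w] by blast
    then have "M w x' s" using UP_in w D by blast
    then show "E w x x'" using UP_iff[OF s(2) w] E_sym by blast
    obtain t where t: "t \<in> D w" "UP w t x y" using pairing[OF w D(1) D(2)] .
    then have "UP w t x' x' \<or> UP w t x' y'" using PAIR_iff[OF P(1) w] PAIR_iff[OF P(2) w] by blast
    moreover have "M w y t" using UP_in t w D by blast
    ultimately show "E w y x' \<or> E w y y'" using UP_iff w by blast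
  qed
  show "E w x x'" using *[OF D assms(6,7)] by blast
  moreover have "E w y x' \<or> E w y y'" using *[OF D assms(6,7)] by blast
  moreover have "E w y' x \<or> E w y' y" using *[OF D(3,4,1,2) assms(7,6)] by blast
  ultimately show "E w y y'" using E_sym E_trans by meson
qed

text \<open>The definition quantifies over all sets \<open>u\<close>. Its part from shape to
  membership is replaced by the demand that \<open>z\<close> contain some singleton and some pair of
  the right shape; as these are unique up to equality, that suffices.\<close>

lemma PAIR_bounded:
  assumes w: "w \<sqsubseteq> w" and D: "x \<in> D w" "y \<in> D w"
  shows "PAIR w z x y \<longleftrightarrow>
     (\<exists>s. M w s z \<and> UP w s x x) \<and> (\<exists>t. M w t z \<and> UP w t x y) \<and>
     (\<forall>w'. w \<sqsubseteq> w' \<longrightarrow> (\<forall>u. M w' u z \<longrightarrow> UP w' u x x \<or> UP w' u x y))" (is "?l \<longleftrightarrow> ?r")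
proof
  assume l: ?l
  obtain s where "s \<in> D w" "UP w s x x" using pairing[OF w D(1) D(1)] .
  moreover obtain t where "t \<in> D w" "UP w t x y" using pairing[OF w D(1) D(2)] .
  ultimately show ?r using PAIR_iff[OF l] w by blast
next
  assume r: ?r
  then obtain s t where st: "M w s z" "UP w s x x" "M w t z" "UP w t x y" by blast
  show ?l
    unfolding PAIR_def
  proof (intro allI impI ballI)
    fix w' u assume w': "w \<sqsubseteq> w'" "u \<in> D w'"
    have w'': "w' \<sqsubseteq> w'" using w' le_reflD by blast
    have s': "M w' s z" "UP w' s x x" and t': "M w' t z" "UP w' t x y"
      using st w' M_mono UP_mono by blast+
    have "M w' u z" if "UP w' u x x \<or> UP w' u x y"
      using that UP_unique[OF w'' _ s'(2)] UP_unique[OF w'' _ t'(2)] s'(1) t'(1) w'(2) M_D M_cong_left E_sym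
      by blast
    then show "M w' u z = (UP w' u x x \<or> UP w' u x y)" using r w' by blast
  qed
qed

lemma UP_bounded:
  assumes w: "w \<sqsubseteq> w" and D: "x \<in> D w" "y \<in> D w"
  shows "UP w c x y \<longleftrightarrow> M w x c \<and> M w y c \<and>
    (\<forall>w'. w \<sqsubseteq> w' \<longrightarrow> (\<forall>u. M w' u c \<longrightarrow> E w' u x \<or> E w' u y))" (is "?l \<longleftrightarrow> ?r")
proof
  assume l: ?l
  then show ?r using UP_in[OF l w] D UP_iff by blast
next
  assume r: ?r
  show ?l unfolding UP_def using r M_mono M_cong_left E_sym by blast
qed

section \<open>Successors and finite sets\<close>

lemma SUCC_iff: "SUCC w y x \<Longrightarrow> w \<sqsubseteq> w' \<Longrightarrow> M w' z y = (M w' z x \<or> E w' z x)"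
  unfolding SUCC_def using M_D E_D by blast

lemma SUCC_cong:
  assumes "SUCC w y x" "E w y y'" "E w x x'"
  shows "SUCC w y' x'"
  unfolding SUCC_def
proof (intro allI impI ballI)
  fix w' z assume w': "w \<sqsubseteq> w'" "z \<in> D w'"
  then have e: "E w' y y'" "E w' x x'" "E w' z z" using assms E_mono le_reflD E_refl by blast+
  then show "M w' z y' = (M w' z x' \<or> E w' z x')"
    using SUCC_iff[OF assms(1) w'(1), of z] M_cong E_sym E_trans by meson
qed

lemma SUCC_unique:
  assumes "w \<sqsubseteq> w" "SUCC w y x" "SUCC w y' x" "y \<in> D w" "y' \<in> D w"
  shows "E w y y'"
  by (rule extensionality) (use assms SUCC_iff in auto)

text \<open>The numeral 0 serves, with the empty set \<open>a\<close> itself as segment, function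
  and image.\<close>

lemma FIN_empty:
  assumes w: "w \<sqsubseteq> w" and a: "a \<in> D w" "EMPTY w a"
  shows "FIN w a"
proof -
  obtain b where b: "b \<in> D w" "OMEGA w b" using infinity[OF w a(1)] .
  then obtain e where e: "M w e b" "EMPTY w e" unfolding OMEGA_def INDUCTIVE_def by blast
  have "SEG w a e" using a(2) e(2) unfolding SEG_def EMPTY_def by blast
  moreover have "FUN w a a" using a(2) unfolding FUN_def EMPTY_def by blast
  moreover have "IMG w a a a" using a(2) unfolding IMG_def EMPTY_def by blast
  ultimately show ?thesis unfolding FIN_def using a(1) b e(1) by blast
qed

text \<open>The enumeration is \<open>{(1, p), (2, q)}\<close> on the segment \<open>{1, 2}\<close>.
  It may repeat values, so equality of \<open>p\<close> and \<open>q\<close> does not have to be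
  decided.\<close>

lemma FIN_upair:
  assumes w: "w \<sqsubseteq> w" and D: "p \<in> D w" "q \<in> D w" and a: "UP w a p q"
  shows "FIN w a"
proof -
  obtain b where b: "b \<in> D w" "OMEGA w b" using infinity[OF w D(1)] .
  then have ind: "INDUCTIVE w b" unfolding OMEGA_def by blast
  then obtain zero where zero: "M w zero b" "EMPTY w zero" unfolding INDUCTIVE_def by blast
  obtain one where one: "M w one b" "SUCC w one zero" using ind zero(1) w unfolding INDUCTIVE_def by blast
  obtain two where two: "M w two b" "SUCC w two one" using ind one(1) w unfolding INDUCTIVE_def by blast
  have nums: "zero \<in> D w" "one \<in> D w" "two \<in> D w" using zero(1) one(1) two(1) M_D by blast+
  obtain d where d: "d \<in> D w" "UP w d one two" using pairing[OF w nums(2,3)] .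
  obtain y where y: "y \<in> D w" "PAIR w y one p" using PAIR_exists[OF w nums(2) D(1)] .
  obtain z where z: "z \<in> D w" "PAIR w z two q" using PAIR_exists[OF w nums(3) D(2)] .
  obtain f where f: "f \<in> D w" "UP w f y z" using pairing[OF w y(1) z(1)] .
  have le: "w' \<sqsubseteq> w'" if "w \<sqsubseteq> w'" for w' using that le_reflD by blast
  have refl: "E w' x x" if "w \<sqsubseteq> w'" "x \<in> D w'" for x w' using E_refl le that by blast
  \<comment> \<open>If 1 = 2, then 1 \<in> 1, hence 1 = 0, hence 0 \<in> 0. This makes
    \<open>f\<close> single-valued.\<close>
  have neq: "\<not> (E w' x one \<and> E w' x two)" if w': "w \<sqsubseteq> w'" for w' x
  proof
    assume "E w' x one \<and> E w' x two"
    then have "E w' one two" using E_sym E_trans by blast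
    moreover have "M w' one two" using SUCC_iff[OF two(2) w'] refl[OF w'] D_mono[OF w'] nums by blast
    ultimately have "M w' one one" using M_cong_right E_sym by blast
    then have "E w' one zero" using SUCC_iff[OF one(2) w'] zero(2) w' unfolding EMPTY_def by blast
    moreover have "M w' zero one" using SUCC_iff[OF one(2) w'] refl[OF w'] D_mono[OF w'] nums by blast
    ultimately have "M w' zero zero" using M_cong_right by blast
    then show False using zero(2) w' unfolding EMPTY_def by blast
  qed
  \<comment> \<open>The graph of \<open>f\<close>, by injectivity of pairs in one direction and
    congruence in the other.\<close>
  have rel: "REL w' f x u \<longleftrightarrow> E w' x one \<and> E w' u p \<or> E w' x two \<and> E w' u q"
    if w': "w \<sqsubseteq> w'" and xu: "x \<in> D w'" "u \<in> D w'" for w' x u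
  proof -
    have DD: "one \<in> D w'" "two \<in> D w'" "p \<in> D w'" "q \<in> D w'" "y \<in> D w'" "z \<in> D w'"
      using D_mono[OF w'] nums D y(1) z(1) by blast+
    have P: "PAIR w' y one p" "PAIR w' z two q" using PAIR_mono[OF w'] y(2) z(2) by blast+
    have yz: "M w' y f" "M w' z f" using UP_iff[OF f(2) w'] DD refl[OF w'] by blast+
    show ?thesis
    proof
      assume "REL w' f x u"
      then obtain s where s: "M w' s f" "PAIR w' s x u" unfolding REL_def by blast
      then have "E w' s y \<or> E w' s z" using UP_iff[OF f(2) w'] by blast
      then have "PAIR w' y x u \<or> PAIR w' z x u"
        using PAIR_cong[OF s(2) _ refl[OF w' xu(1)] refl[OF w' xu(2)]] by blast
      then show "E w' x one \<and> E w' u p \<or> E w' x two \<and> E w' u q"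
        using PAIR_inject[OF le[OF w'] xu] P DD by blast
    next
      assume "E w' x one \<and> E w' u p \<or> E w' x two \<and> E w' u q"
      then have "PAIR w' y x u \<or> PAIR w' z x u"
        using PAIR_cong[OF P(1) refl[OF w' DD(5)]] PAIR_cong[OF P(2) refl[OF w' DD(6)]] E_sym by blast
      then show "REL w' f x u" unfolding REL_def using yz by blast
    qed
  qed
  have "SEG w d two"
    unfolding SEG_def
  proof (intro allI impI ballI)
    fix w' k assume w': "w \<sqsubseteq> w'" and k: "k \<in> D w'"
    have DD: "zero \<in> D w'" "one \<in> D w'" "two \<in> D w'" using D_mono[OF w'] nums by blast+
    have S: "SUCC w' one zero" "SUCC w' two one" using SUCC_mono[OF w'] one(2) two(2) by blast+
    \<comment> \<open>The elements of 2 are 0 and 1, with successors 1 and 2: the segment is shifted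
      by one against the numeral.\<close>
    have in_two: "M w' m two \<longleftrightarrow> E w' m zero \<or> E w' m one" for m
      using SUCC_iff[OF one(2) w'] SUCC_iff[OF two(2) w'] zero(2) w' unfolding EMPTY_def by blast
    have "E w' k one \<longleftrightarrow> SUCC w' k zero" "E w' k two \<longleftrightarrow> SUCC w' k one"
      using SUCC_unique[OF le[OF w']] SUCC_cong S DD k E_sym refl[OF w'] by blast+
    moreover have "SUCC w' k m \<longleftrightarrow> SUCC w' k m'" if "E w' m m'" for m m'
      using SUCC_cong refl[OF w' k] that E_sym by blast
    moreover have "M w' zero two" "M w' one two" using in_two DD refl[OF w'] by blast+
    ultimately show "M w' k d = (\<exists>m. M w' m two \<and> SUCC w' k m)"
      unfolding UP_iff[OF d(2) w'] using in_two by blast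
  qed
  moreover have "FUN w f d"
    unfolding FUN_def
  proof (intro conjI allI impI)
    fix w' s assume w': "w \<sqsubseteq> w'" and s: "M w' s f"
    have DD: "one \<in> D w'" "two \<in> D w'" "p \<in> D w'" "q \<in> D w'" using D_mono[OF w'] nums D by blast+
    have "E w' s y \<or> E w' s z" using UP_iff[OF f(2) w'] s by blast
    then have "PAIR w' s one p \<or> PAIR w' s two q"
      using PAIR_cong PAIR_mono[OF w'] y(2) z(2) refl[OF w'] E_sym DD by blast
    moreover have "M w' one d" "M w' two d" using UP_iff[OF d(2) w'] refl[OF w'] DD by blast+
    ultimately show "\<exists>x. M w' x d \<and> (\<exists>y\<in>D w'. PAIR w' s x y)" using DD by blast
  next
    fix w' x assume w': "w \<sqsubseteq> w'" and x: "M w' x d"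
    have DD: "p \<in> D w'" "q \<in> D w'" "x \<in> D w'" using D_mono[OF w'] D x M_D by blast+
    have "E w' x one \<or> E w' x two" using UP_iff[OF d(2) w'] x by blast
    then obtain u where u: "u \<in> D w'" "REL w' f x u"
      "E w' x one \<and> u = p \<or> E w' x two \<and> u = q"
      using rel[OF w' DD(3)] DD refl[OF w'] by blast
    have "E w'' u' u" if w'': "w' \<sqsubseteq> w''" "u' \<in> D w''" "REL w'' f x u'" for w'' u'
    proof -
      have "w \<sqsubseteq> w''" using le_trans w' w'' by blast
      then show ?thesis using rel[of w'' x u'] neq[of w'' x] that u(3) D_mono[OF w''(1)] DD E_mono[OF w''(1)]
        by blast
    qed
    then show "\<exists>u\<in>D w'. REL w' f x u \<and> (\<forall>w''. w' \<sqsubseteq> w'' \<longrightarrow> (\<forall>u'\<in>D w''. REL w'' f x u' \<longrightarrow> E w'' u' u))"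
      using u by blast
  qed
  moreover have "IMG w a f d"
    unfolding IMG_def
  proof (intro allI impI ballI)
    fix w' u assume w': "w \<sqsubseteq> w'" and u: "u \<in> D w'"
    have DD: "one \<in> D w'" "two \<in> D w'" using D_mono[OF w'] nums by blast+
    show "M w' u a = (\<exists>x. M w' x d \<and> REL w' f x u)"
      unfolding UP_iff[OF a w'] UP_iff[OF d(2) w'] using rel[OF w' _ u] refl[OF w'] DD E_D by blast
  qed
  ultimately show ?thesis unfolding FIN_def using b two(1) d(1) f(1) by blast
qed

end

text \<open>\<open>is_pair\<close> is not a bounded formula, so Bounded Separation needs this equivalent one.\<close>

definition bounded_upair :: "nat \<Rightarrow> nat \<Rightarrow> nat \<Rightarrow> form" where
  "bounded_upair c x y = (x \<^bold>\<in> c \<^bold>\<and> y \<^bold>\<in> c \<^bold>\<and> (\<^bold>\<forall>u\<^bold>\<in>c. u \<^bold>= x \<^bold>\<or> u \<^bold>= y))"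

definition bounded_pair :: "nat \<Rightarrow> nat \<Rightarrow> nat \<Rightarrow> form" where
  "bounded_pair z x y = ((\<^bold>\<exists>s\<^bold>\<in>z. bounded_upair s x x) \<^bold>\<and> (\<^bold>\<exists>t\<^bold>\<in>z. bounded_upair t x y) \<^bold>\<and>
     (\<^bold>\<forall>u\<^bold>\<in>z. bounded_upair u x x \<^bold>\<or> bounded_upair u x y))"

lemma bounded_connectives:
  "bounded ((x \<^bold>\<in> y) d)" "bounded ((x \<^bold>= y) d)"
  "bounded (F d) \<Longrightarrow> bounded (G d) \<Longrightarrow> bounded ((F \<^bold>\<and> G) d)"
  "bounded (F d) \<Longrightarrow> bounded (G d) \<Longrightarrow> bounded ((F \<^bold>\<or> G) d)"
  by (auto simp: mem_def eq_def conj_def disj_def intro: bounded.intros)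

text \<open>Below the quantifier the index \<open>d - Suc a\<close> becomes its successor, so the
  bound has the form that \<open>bounded\<close> demands. For \<open>a \<ge> d\<close> truncated
  subtraction would make the bound index 0, the quantified variable itself.\<close>

lemma bounded_all_in: "a < d \<Longrightarrow> bounded (H d (Suc d)) \<Longrightarrow> bounded (all_in a H d)"
  using bounded.intros(7)[of "H d (Suc d)" "d - Suc a"]
  by (simp add: all_in_def all_def imp_def mem_def Suc_diff_Suc)

lemma bounded_ex_in: "a < d \<Longrightarrow> bounded (H d (Suc d)) \<Longrightarrow> bounded (ex_in a H d)"
  using bounded.intros(8)[of "H d (Suc d)" "d - Suc a"]
  by (simp add: ex_in_def ex_def conj_def mem_def Suc_diff_Suc)

lemma bounded_bounded_pair: "z < d \<Longrightarrow> bounded (bounded_pair z x y d)"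
  unfolding bounded_pair_def bounded_upair_def
  by (intro bounded_connectives bounded_all_in bounded_ex_in) auto

section \<open>Sets obtained by Bounded Separation and Union\<close>

context czf_model
begin

lemma holds_bounded_upair:
  assumes "c < length es" "x < length es" "y < length es"
    and "w \<sqsubseteq> w" "es ! x \<in> D w" "es ! y \<in> D w"
  shows "holds \<rho> w es (bounded_upair c x y) = UP w (es ! c) (es ! x) (es ! y)"
  using assms unfolding UP_bounded[OF assms(4-)] bounded_upair_def by (simp add: nth_append)

lemma holds_bounded_pair:
  assumes "z < length es" "x < length es" "y < length es"
    and w: "w \<sqsubseteq> w" and "es ! x \<in> D w" "es ! y \<in> D w"
  shows "holds \<rho> w es (bounded_pair z x y) = PAIR w (es ! z) (es ! x) (es ! y)"
proof -
  have "holds \<rho> w' (es @ [u]) (bounded_upair (length es) i j) = UP w' u (es ! i) (es ! j)"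
    if "w \<sqsubseteq> w'" "i \<in> {x, y}" "j \<in> {x, y}" for w' u i j
    using holds_bounded_upair[of "length es" "es @ [u]" i j w'] that assms le_reflD D_mono
    by (auto simp: nth_append)
  then show ?thesis
    using assms unfolding PAIR_bounded[OF w assms(5,6)] bounded_pair_def by simp
qed

lemma down_exists:
  assumes w: "w \<sqsubseteq> w" and D: "P \<in> D w" "L \<in> D w" "p \<in> D w" "q \<in> D w"
  obtains b where "b \<in> D w"
    "\<And>w' x. w \<sqsubseteq> w' \<Longrightarrow> M w' x b = (M w' x P \<and> REL w' L x p \<and> REL w' L x q)"
proof -
  \<comment> \<open>Levels 0, 1, 2 are \<open>L\<close>, \<open>p\<close>, \<open>q\<close>; level 3
    is the element to be separated.\<close>
  let ?F = "(\<^bold>\<exists>z\<^bold>\<in>0. bounded_pair z 3 1) \<^bold>\<and> (\<^bold>\<exists>z\<^bold>\<in>0. bounded_pair z 3 2)"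
  have "bounded (?F (Suc (length [L, p, q])))"
    by (intro bounded_connectives bounded_ex_in bounded_bounded_pair) auto
  then obtain b where b: "b \<in> D w"
    "\<And>w' x. w \<sqsubseteq> w' \<Longrightarrow> M w' x b = (M w' x P \<and> holds (\<lambda>_. P) w' ([L, p, q] @ [x]) ?F)"
    using separation[OF w D(1), of "[L, p, q]" "\<lambda>_. P" ?F] D by auto
  have "holds (\<lambda>_. P) w' ([L, p, q] @ [x]) ?F \<longleftrightarrow> REL w' L x p \<and> REL w' L x q"
    if w': "w \<sqsubseteq> w'" and x: "M w' x P" for w' x
  proof -
    have "holds (\<lambda>_. P) w' [L, p, q, x, z] (bounded_pair 4 3 1) = PAIR w' z x p"
      "holds (\<lambda>_. P) w' [L, p, q, x, z] (bounded_pair 4 3 2) = PAIR w' z x q" for z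
      using holds_bounded_pair[of 4 "[L, p, q, x, z]" 3 1 w']
        holds_bounded_pair[of 4 "[L, p, q, x, z]" 3 2 w'] w' x D le_reflD[OF w'] D_mono[OF w'] M_D[OF x]
      by auto
    then show ?thesis by (auto simp: REL_def numeral_eq_Suc)
  qed
  with b that show thesis by metis
qed

lemma binary_union:
  assumes w: "w \<sqsubseteq> w" and D: "a \<in> D w" "b \<in> D w"
  obtains c where "c \<in> D w" "\<And>w' x. w \<sqsubseteq> w' \<Longrightarrow> M w' x c = (M w' x a \<or> M w' x b)"
proof -
  obtain s where s: "s \<in> D w" "UP w s a b" using pairing[OF w D] .
  obtain c where c: "c \<in> D w" "\<And>w' x. w \<sqsubseteq> w' \<Longrightarrow> M w' x c = (\<exists>y. M w' y s \<and> M w' x y)"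
    using union[OF w s(1)] by blast
  have "M w' x c = (M w' x a \<or> M w' x b)" if w': "w \<sqsubseteq> w'" for w' x
  proof -
    have "E w' a a" "E w' b b" using D_mono[OF w'] D E_refl le_reflD[OF w'] by blast+
    then show ?thesis unfolding c(2)[OF w'] UP_iff[OF s(2) w'] using M_cong_right by blast
  qed
  with c(1) that show thesis by blast
qed

end

section \<open>The points of a set-presented formal space\<close>

text \<open>This is what collection records about a rule. The quantifier over all points is
  unbounded, which Strong Collection permits.\<close>

definition sound_rule :: "nat \<Rightarrow> nat \<Rightarrow> (nat \<Rightarrow> nat \<Rightarrow> form) \<Rightarrow> nat \<Rightarrow> form" where
  "sound_rule P L cov r = (\<^bold>\<exists>a b. is_pair r a b \<^bold>\<and> a \<^bold>\<subseteq> P \<^bold>\<and> b \<^bold>\<subseteq> P \<^bold>\<and> is_finite a \<^bold>\<and>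
     (\<^bold>\<forall>\<alpha>. point P L cov \<alpha> \<^bold>\<longrightarrow> a \<^bold>\<subseteq> \<alpha> \<^bold>\<longrightarrow> (\<^bold>\<exists>x\<^bold>\<in>b. x \<^bold>\<in> \<alpha>)))"

definition is_upair :: "nat \<Rightarrow> nat \<Rightarrow> nat \<Rightarrow> form" where
  "is_upair c x y = (\<^bold>\<forall>u. u \<^bold>\<in> c \<^bold>\<longleftrightarrow> u \<^bold>= x \<^bold>\<or> u \<^bold>= y)"

text \<open>The conclusion may be any set of common lower bounds, as closure under such a rule
  already gives directedness.\<close>

definition meet_rule :: "nat \<Rightarrow> nat \<Rightarrow> nat \<Rightarrow> nat \<Rightarrow> form" where
  "meet_rule L r p q = (\<^bold>\<exists>a b. is_pair r a b \<^bold>\<and> is_upair a p q \<^bold>\<and>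
     (\<^bold>\<forall>c\<^bold>\<in>b. related L c p \<^bold>\<and> related L c q))"

text \<open>Inclusion in \<open>S\<close>, in place of equality, lets the rule of one basic cover
  serve every larger cover.\<close>

definition cover_rule :: "nat \<Rightarrow> nat \<Rightarrow> nat \<Rightarrow> form" where
  "cover_rule r a S = (\<^bold>\<exists>x y. is_pair r x y \<^bold>\<and> is_upair x a a \<^bold>\<and> y \<^bold>\<subseteq> S)"

text \<open>Collecting for a fixed \<open>a\<close> and then over all \<open>a\<close> avoids
  forming sets of pairs \<open>(p, q)\<close> or \<open>(a, S)\<close> to collect over.\<close>

definition rules_at :: "nat \<Rightarrow> nat \<Rightarrow> (nat \<Rightarrow> nat \<Rightarrow> form) \<Rightarrow> nat \<Rightarrow> nat \<Rightarrow> form" where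
  "rules_at P L cov Y a = ((\<^bold>\<forall>r\<^bold>\<in>Y. sound_rule P L cov r) \<^bold>\<and>
     (\<^bold>\<forall>q\<^bold>\<in>P. \<^bold>\<exists>r\<^bold>\<in>Y. meet_rule L r a q) \<^bold>\<and>
     (\<^bold>\<forall>S\<^bold>\<subseteq>P. cov a S \<^bold>\<longrightarrow> (\<^bold>\<exists>r\<^bold>\<in>Y. cover_rule r a S)))"

section \<open>Forcing of the formulas about points and rules\<close>

context kripke
begin

lemma holds_mono: "v \<sqsubseteq> w \<Longrightarrow> holds \<rho> v es F \<Longrightarrow> holds \<rho> w es F"
  unfolding holds_def by (rule forces_mono)

definition COV :: "fm \<Rightarrow> (nat \<Rightarrow> nat) \<Rightarrow> 'w \<Rightarrow> nat \<Rightarrow> nat \<Rightarrow> bool" where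
  "COV cover \<rho> w a U \<longleftrightarrow> forces w (case_nat a (case_nat U \<rho>)) cover"

definition POINT :: "fm \<Rightarrow> (nat \<Rightarrow> nat) \<Rightarrow> 'w \<Rightarrow> nat \<Rightarrow> nat \<Rightarrow> nat \<Rightarrow> bool" where
  "POINT cover \<rho> w P L \<alpha> \<longleftrightarrow> SUB w \<alpha> P \<and> (\<exists>p. M w p \<alpha>) \<and>
     (\<forall>w' p q. w \<sqsubseteq> w' \<longrightarrow> M w' p \<alpha> \<longrightarrow> M w' q P \<longrightarrow> REL w' L p q \<longrightarrow> M w' q \<alpha>) \<and>
     (\<forall>w' p q. w \<sqsubseteq> w' \<longrightarrow> M w' p \<alpha> \<longrightarrow> M w' q \<alpha> \<longrightarrow> (\<exists>r. M w' r \<alpha> \<and> REL w' L r p \<and> REL w' L r q)) \<and>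
     (\<forall>w' a S. w \<sqsubseteq> w' \<longrightarrow> M w' a \<alpha> \<longrightarrow> S \<in> D w' \<longrightarrow> SUB w' S P \<longrightarrow> COV cover \<rho> w' a S \<longrightarrow>
        (\<exists>x. M w' x S \<and> M w' x \<alpha>))"

definition SOUND :: "fm \<Rightarrow> (nat \<Rightarrow> nat) \<Rightarrow> 'w \<Rightarrow> nat \<Rightarrow> nat \<Rightarrow> nat \<Rightarrow> bool" where
  "SOUND cover \<rho> w P L r \<longleftrightarrow> (\<exists>a\<in>D w. \<exists>b\<in>D w. PAIR w r a b \<and> SUB w a P \<and> SUB w b P \<and> FIN w a \<and>
     (\<forall>w' \<alpha>. w \<sqsubseteq> w' \<longrightarrow> \<alpha> \<in> D w' \<longrightarrow> POINT cover \<rho> w' P L \<alpha> \<longrightarrow> SUB w' a \<alpha> \<longrightarrow>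
        (\<exists>x. M w' x b \<and> M w' x \<alpha>)))"

definition MEET :: "'w \<Rightarrow> nat \<Rightarrow> nat \<Rightarrow> nat \<Rightarrow> nat \<Rightarrow> bool" where
  "MEET w L r p q \<longleftrightarrow> (\<exists>a\<in>D w. \<exists>b\<in>D w. PAIR w r a b \<and> UP w a p q \<and>
     (\<forall>w' c. w \<sqsubseteq> w' \<longrightarrow> M w' c b \<longrightarrow> REL w' L c p \<and> REL w' L c q))"

definition COVER_RULE :: "'w \<Rightarrow> nat \<Rightarrow> nat \<Rightarrow> nat \<Rightarrow> bool" where
  "COVER_RULE w r a S \<longleftrightarrow> (\<exists>x\<in>D w. \<exists>y\<in>D w. PAIR w r x y \<and> UP w x a a \<and> SUB w y S)"

definition RULES_AT :: "fm \<Rightarrow> (nat \<Rightarrow> nat) \<Rightarrow> 'w \<Rightarrow> nat \<Rightarrow> nat \<Rightarrow> nat \<Rightarrow> nat \<Rightarrow> bool" where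
  "RULES_AT cover \<rho> w P L Y a \<longleftrightarrow>
     (\<forall>w' r. w \<sqsubseteq> w' \<longrightarrow> M w' r Y \<longrightarrow> SOUND cover \<rho> w' P L r) \<and>
     (\<forall>w' q. w \<sqsubseteq> w' \<longrightarrow> M w' q P \<longrightarrow> (\<exists>r. M w' r Y \<and> MEET w' L r a q)) \<and>
     (\<forall>w' S. w \<sqsubseteq> w' \<longrightarrow> S \<in> D w' \<longrightarrow> SUB w' S P \<longrightarrow> COV cover \<rho> w' a S \<longrightarrow>
        (\<exists>r. M w' r Y \<and> COVER_RULE w' r a S))"

definition CLOSED :: "'w \<Rightarrow> nat \<Rightarrow> nat \<Rightarrow> nat \<Rightarrow> bool" where
  "CLOSED w X R Y \<longleftrightarrow> SUB w Y X \<and>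
     (\<forall>w' r a b. w \<sqsubseteq> w' \<longrightarrow> M w' r R \<longrightarrow> a \<in> D w' \<longrightarrow> b \<in> D w' \<longrightarrow> PAIR w' r a b \<longrightarrow> SUB w' a Y \<longrightarrow>
        (\<exists>x. M w' x b \<and> M w' x Y))"

lemma holds_class_rel [simp]:
  "x < length es \<Longrightarrow> y < length es \<Longrightarrow>
   holds \<rho> w es (class_rel cover x y) = COV cover \<rho> w (es ! x) (es ! y)"
  by (simp add: class_rel_def COV_def holds_app env_Cons_Nil)

lemma COV_mono: "v \<sqsubseteq> w \<Longrightarrow> COV cover \<rho> v a U \<Longrightarrow> COV cover \<rho> w a U"
  unfolding COV_def by (rule forces_mono)

text \<open>A persistent antecedent can be evaluated again at the later world, so the two worlds
  merge into one. This brings nested quantifiers into the single-world form of definitions such as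
  \<open>POINT\<close>.\<close>

lemma collapse:
  assumes mono: "\<And>v u t. v \<sqsubseteq> u \<Longrightarrow> A v t \<Longrightarrow> A u t"
  shows "(\<forall>w'. w \<sqsubseteq> w' \<longrightarrow> (\<forall>t. A w' t \<longrightarrow> (\<forall>w''. w' \<sqsubseteq> w'' \<longrightarrow> F w'' t))) =
    (\<forall>w'. w \<sqsubseteq> w' \<longrightarrow> (\<forall>t. A w' t \<longrightarrow> F w' t))" (is "?l = ?r")
proof
  assume l: ?l
  show ?r
  proof (intro allI impI)
    fix w' t assume w': "w \<sqsubseteq> w'" "A w' t"
    then have "w' \<sqsubseteq> w'" using le_reflD by blast
    then show "F w' t" using l w' by blast
  qed
next
  assume r: ?r
  show ?l
  proof (intro allI impI)
    fix w' t w'' assume *: "w \<sqsubseteq> w'" "A w' t" "w' \<sqsubseteq> w''"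
    then show "F w'' t" using r le_trans[OF *(1,3)] mono[OF *(3,2)] by blast
  qed
qed

lemma collapse_mem:
  "(\<forall>w'. w \<sqsubseteq> w' \<longrightarrow> (\<forall>t. M w' t x \<longrightarrow> (\<forall>w''. w' \<sqsubseteq> w'' \<longrightarrow> F w'' t))) =
   (\<forall>w'. w \<sqsubseteq> w' \<longrightarrow> (\<forall>t. M w' t x \<longrightarrow> F w' t))"
  by (rule collapse) (rule M_mono)

lemma collapse_dom:
  assumes "\<And>v u t. v \<sqsubseteq> u \<Longrightarrow> A v t \<Longrightarrow> A u t"
  shows "(\<forall>w'. w \<sqsubseteq> w' \<longrightarrow> (\<forall>t\<in>D w'. A w' t \<longrightarrow> (\<forall>w''. w' \<sqsubseteq> w'' \<longrightarrow> F w'' t))) =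
   (\<forall>w'. w \<sqsubseteq> w' \<longrightarrow> (\<forall>t\<in>D w'. A w' t \<longrightarrow> F w' t))"
  using collapse[of "\<lambda>w t. t \<in> D w \<and> A w t" w F] assms D_mono by (auto simp: Ball_def)

lemmas collapse_sub = collapse_dom[OF SUB_mono]

lemma holds_point [simp]:
  assumes "P < length es" "L < length es" "\<alpha> < length es"
  shows "holds \<rho> w es (point P L (class_rel cover) \<alpha>) =
    POINT cover \<rho> w (es ! P) (es ! L) (es ! \<alpha>)"
proof -
  have "holds \<rho> w es (\<^bold>\<forall>p\<^bold>\<in>\<alpha>. \<^bold>\<forall>q\<^bold>\<in>P. related L p q \<^bold>\<longrightarrow> q \<^bold>\<in> \<alpha>) =
      (\<forall>w' p q. w \<sqsubseteq> w' \<longrightarrow> M w' p (es ! \<alpha>) \<longrightarrow> M w' q (es ! P) \<longrightarrow> REL w' (es ! L) p q \<longrightarrow> M w' q (es ! \<alpha>))"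
    using assms by (simp add: nth_append collapse_mem collapse_sub)
  moreover have "holds \<rho> w es (\<^bold>\<forall>p\<^bold>\<in>\<alpha>. \<^bold>\<forall>q\<^bold>\<in>\<alpha>. \<^bold>\<exists>r\<^bold>\<in>\<alpha>. related L r p \<^bold>\<and> related L r q) =
      (\<forall>w' p q. w \<sqsubseteq> w' \<longrightarrow> M w' p (es ! \<alpha>) \<longrightarrow> M w' q (es ! \<alpha>) \<longrightarrow>
        (\<exists>r. M w' r (es ! \<alpha>) \<and> REL w' (es ! L) r p \<and> REL w' (es ! L) r q))"
    using assms by (simp add: nth_append collapse_mem collapse_sub)
  moreover have "holds \<rho> w es (\<^bold>\<forall>a\<^bold>\<in>\<alpha>. \<^bold>\<forall>S\<^bold>\<subseteq>P. class_rel cover a S \<^bold>\<longrightarrow> (\<^bold>\<exists>x\<^bold>\<in>S. x \<^bold>\<in> \<alpha>)) =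
      (\<forall>w' a S. w \<sqsubseteq> w' \<longrightarrow> M w' a (es ! \<alpha>) \<longrightarrow> S \<in> D w' \<longrightarrow> SUB w' S (es ! P) \<longrightarrow>
        COV cover \<rho> w' a S \<longrightarrow> (\<exists>x. M w' x S \<and> M w' x (es ! \<alpha>)))"
    using assms by (simp add: nth_append collapse_mem collapse_sub) blast
  moreover have "(\<exists>p\<in>D w. M w p (es ! \<alpha>)) = (\<exists>p. M w p (es ! \<alpha>))" using M_D by blast
  ultimately show ?thesis
    using assms unfolding point_def POINT_def holds_connectives by (simp add: nth_append)
qed

lemma holds_sound_rule [simp]:
  assumes "P < length es" "L < length es" "r < length es"
  shows "holds \<rho> w es (sound_rule P L (class_rel cover) r) =
    SOUND cover \<rho> w (es ! P) (es ! L) (es ! r)"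
proof -
  \<comment> \<open>Persistence is inherited from forcing: \<open>POINT\<close> is the meaning of a
    formula in the levels 0, 1, 2.\<close>
  have "POINT cover \<rho> v (es ! P) (es ! L) t \<Longrightarrow> POINT cover \<rho> u (es ! P) (es ! L) t"
    if "v \<sqsubseteq> u" for u v t
    using holds_mono[OF that, of \<rho> "[es ! P, es ! L, t]" "point 0 1 (class_rel cover) 2"] by simp
  note * = collapse_dom[of "\<lambda>w. POINT cover \<rho> w (es ! P) (es ! L)", OF this]
  show ?thesis
    using assms unfolding sound_rule_def SOUND_def by (simp add: nth_append *) blast
qed

lemma holds_is_upair [simp]:
  "c < length es \<Longrightarrow> x < length es \<Longrightarrow> y < length es \<Longrightarrow>
   holds \<rho> w es (is_upair c x y) = UP w (es ! c) (es ! x) (es ! y)"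
  by (simp add: is_upair_def UP_def nth_append)

lemma holds_meet_rule [simp]:
  "L < length es \<Longrightarrow> r < length es \<Longrightarrow> p < length es \<Longrightarrow> q < length es \<Longrightarrow>
   holds \<rho> w es (meet_rule L r p q) = MEET w (es ! L) (es ! r) (es ! p) (es ! q)"
  by (simp add: meet_rule_def MEET_def nth_append)

lemma holds_cover_rule [simp]:
  "r < length es \<Longrightarrow> a < length es \<Longrightarrow> S < length es \<Longrightarrow>
   holds \<rho> w es (cover_rule r a S) = COVER_RULE w (es ! r) (es ! a) (es ! S)"
  by (simp add: cover_rule_def COVER_RULE_def nth_append)

lemma holds_rules_at [simp]:
  assumes "P < length es" "L < length es" "Y < length es" "a < length es"
  shows "holds \<rho> w es (rules_at P L (class_rel cover) Y a) =
    RULES_AT cover \<rho> w (es ! P) (es ! L) (es ! Y) (es ! a)"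
proof -
  have "holds \<rho> w es (\<^bold>\<forall>S\<^bold>\<subseteq>P. class_rel cover a S \<^bold>\<longrightarrow> (\<^bold>\<exists>r\<^bold>\<in>Y. cover_rule r a S)) =
    (\<forall>w' S. w \<sqsubseteq> w' \<longrightarrow> S \<in> D w' \<longrightarrow> SUB w' S (es ! P) \<longrightarrow> COV cover \<rho> w' (es ! a) S \<longrightarrow>
        (\<exists>r. M w' r (es ! Y) \<and> COVER_RULE w' r (es ! a) S))"
    using assms by (simp add: nth_append collapse_sub) blast
  then show ?thesis
    using assms unfolding rules_at_def RULES_AT_def holds_connectives by (simp add: nth_append)
qed

lemma holds_closed_subset [simp]:
  assumes "X < length es" "R < length es" "Y < length es"
  shows "holds \<rho> w es (closed_subset X R Y) = CLOSED w (es ! X) (es ! R) (es ! Y)"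
proof -
  have "holds \<rho> w es (\<^bold>\<forall>r\<^bold>\<in>R. \<^bold>\<forall>a b. is_pair r a b \<^bold>\<longrightarrow> a \<^bold>\<subseteq> Y \<^bold>\<longrightarrow> (\<^bold>\<exists>x\<^bold>\<in>b. x \<^bold>\<in> Y)) \<longleftrightarrow>
     (\<forall>w' r a b. w \<sqsubseteq> w' \<longrightarrow> M w' r (es ! R) \<longrightarrow> a \<in> D w' \<longrightarrow> b \<in> D w' \<longrightarrow> PAIR w' r a b \<longrightarrow>
        SUB w' a (es ! Y) \<longrightarrow> (\<exists>x. M w' x b \<and> M w' x (es ! Y)))" (is "?l \<longleftrightarrow> ?r")
  proof -
    \<comment> \<open>The quantifiers over \<open>a\<close> and \<open>b\<close> follow each other
      with no antecedent in between and so contribute separate worlds; monotonicity then moves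
      everything to the last one.\<close>
    have "?l \<longleftrightarrow> (\<forall>w'. w \<sqsubseteq> w' \<longrightarrow> (\<forall>r. M w' r (es ! R) \<longrightarrow> (\<forall>w1. w' \<sqsubseteq> w1 \<longrightarrow> (\<forall>a\<in>D w1.
       \<forall>w2. w1 \<sqsubseteq> w2 \<longrightarrow> (\<forall>b\<in>D w2. PAIR w2 r a b \<longrightarrow> (\<forall>w3. w2 \<sqsubseteq> w3 \<longrightarrow> SUB w3 a (es ! Y) \<longrightarrow>
       (\<exists>x. M w3 x b \<and> M w3 x (es ! Y))))))))"
      using assms by (simp add: holds_all[of _ _ "es @ [_]"] nth_append)
    also have "\<dots> \<longleftrightarrow> ?r" (is "?m \<longleftrightarrow> _")
    proof
      show ?r if ?m using that le_reflD by meson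
    next
      assume r: ?r
      show ?m
      proof (intro allI impI ballI)
        fix w' r w1 a w2 b w3
        assume *: "w \<sqsubseteq> w'" "M w' r (es ! R)" "w' \<sqsubseteq> w1" "a \<in> D w1" "w1 \<sqsubseteq> w2" "b \<in> D w2"
          "PAIR w2 r a b" "w2 \<sqsubseteq> w3" "SUB w3 a (es ! Y)"
        then have "w1 \<sqsubseteq> w3" "w' \<sqsubseteq> w3" using le_trans by blast+
        then have "w \<sqsubseteq> w3" "M w3 r (es ! R)" "a \<in> D w3" "b \<in> D w3" "PAIR w3 r a b"
          using * le_trans M_mono D_mono PAIR_mono by blast+
        then show "\<exists>x. M w3 x b \<and> M w3 x (es ! Y)" using r * by blast
      qed
    qed
    finally show ?thesis .
  qed
  then show ?thesis
    using assms unfolding closed_subset_def CLOSED_def holds_connectives by simp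
qed

end

section \<open>The set of rules of a set-presented space\<close>

text \<open>The facts about the space speak of one world \<open>v\<close> above \<open>w\<close>,
  with the nested worlds of forcing already merged. The set \<open>BCov(a)\<close> appears as an
  element \<open>B\<close> obtained separately for each \<open>v\<close> and
  \<open>a\<close>.\<close>

locale presented_space = czf_model le D M E
  for le :: "'w \<Rightarrow> 'w \<Rightarrow> bool"  (infix \<open>\<sqsubseteq>\<close> 50) and D M E +
  fixes cover :: fm and \<rho> :: "nat \<Rightarrow> nat" and w :: 'w and P L :: nat
  assumes w: "w \<sqsubseteq> w" and D: "P \<in> D w" "L \<in> D w" "range \<rho> \<subseteq> D w"
    and cov_mem: "w \<sqsubseteq> v \<Longrightarrow> M v a P \<Longrightarrow> U \<in> D v \<Longrightarrow> SUB v U P \<Longrightarrow> M v a U \<Longrightarrow> COV cover \<rho> v a U"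
    and cov_le: "w \<sqsubseteq> v \<Longrightarrow> M v a P \<Longrightarrow> M v b P \<Longrightarrow> U \<in> D v \<Longrightarrow> SUB v U P \<Longrightarrow> REL v L a b \<Longrightarrow>
      COV cover \<rho> v b U \<Longrightarrow> COV cover \<rho> v a U"
    and presented: "w \<sqsubseteq> v \<Longrightarrow> M v a P \<Longrightarrow> \<exists>B\<in>D v. (\<forall>v' S. v \<sqsubseteq> v' \<longrightarrow> M v' S B \<longrightarrow> SUB v' S P) \<and>
      (\<forall>v' U. v \<sqsubseteq> v' \<longrightarrow> U \<in> D v' \<longrightarrow> SUB v' U P \<longrightarrow>
        COV cover \<rho> v' a U = (\<exists>S. M v' S B \<and> SUB v' S U))"
begin

abbreviation "cov \<equiv> COV cover \<rho>"
abbreviation "is_point v \<equiv> POINT cover \<rho> v P L"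
abbreviation "sound v \<equiv> SOUND cover \<rho> v P L"
abbreviation "rules v \<equiv> RULES_AT cover \<rho> v P L"

lemma above: "w \<sqsubseteq> v \<Longrightarrow> v \<sqsubseteq> v \<and> P \<in> D v \<and> L \<in> D v \<and> range \<rho> \<subseteq> D v"
  using le_reflD D D_mono by blast

lemma point_mono: "v \<sqsubseteq> u \<Longrightarrow> is_point v \<alpha> \<Longrightarrow> is_point u \<alpha>"
  using holds_mono[of v u \<rho> "[P, L, \<alpha>]" "point 0 1 (class_rel cover) 2"] by simp

lemma sound_mono: "v \<sqsubseteq> u \<Longrightarrow> sound v r \<Longrightarrow> sound u r"
  using holds_mono[of v u \<rho> "[P, L, r]" "sound_rule 0 1 (class_rel cover) 2"] by simp

lemma pointD:
  assumes "is_point v \<alpha>"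
  shows "SUB v \<alpha> P" "\<exists>p. M v p \<alpha>"
    "\<forall>u p q. v \<sqsubseteq> u \<longrightarrow> M u p \<alpha> \<longrightarrow> M u q \<alpha> \<longrightarrow> (\<exists>r. M u r \<alpha> \<and> REL u L r p \<and> REL u L r q)"
    "\<forall>u a S. v \<sqsubseteq> u \<longrightarrow> M u a \<alpha> \<longrightarrow> S \<in> D u \<longrightarrow> SUB u S P \<longrightarrow> cov u a S \<longrightarrow>
      (\<exists>x. M u x S \<and> M u x \<alpha>)"
  using assms unfolding POINT_def by - (elim conjE, assumption)+

lemma rulesD:
  assumes "rules v Y a" "v \<sqsubseteq> v"
  shows "M v r Y \<Longrightarrow> sound v r"
    "M v q P \<Longrightarrow> \<exists>r. M v r Y \<and> MEET v L r a q"
    "S \<in> D v \<Longrightarrow> SUB v S P \<Longrightarrow> cov v a S \<Longrightarrow> \<exists>r. M v r Y \<and> COVER_RULE v r a S"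
  using assms unfolding RULES_AT_def by simp_all

lemma SOUNDI:
  assumes "a \<in> D v" "b \<in> D v" "PAIR v r a b" "SUB v a P" "SUB v b P" "FIN v a"
    and "\<And>u \<alpha>. v \<sqsubseteq> u \<Longrightarrow> is_point u \<alpha> \<Longrightarrow> SUB u a \<alpha> \<Longrightarrow> \<exists>x. M u x b \<and> M u x \<alpha>"
  shows "sound v r"
  unfolding SOUND_def using assms by blast

lemma SUB_UP:
  assumes "UP v a p q" "v \<sqsubseteq> v" "M v p \<alpha>" "M v q \<alpha>"
  shows "SUB v a \<alpha>"
  unfolding SUB_def
proof (intro allI impI)
  fix v' z assume v': "v \<sqsubseteq> v'" and "M v' z a"
  then have "E v' z p \<or> E v' z q" using UP_iff[OF assms(1)] by blast
  then show "M v' z \<alpha>" using M_mono[OF v'] assms(3,4) M_cong_left E_sym by blast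
qed

text \<open>The conclusion is the set of all common lower bounds in \<open>P\<close>. A point that
  contains \<open>p\<close> and \<open>q\<close> is directed and lies in \<open>P\<close>, hence
  meets it.\<close>

lemma meet_rule_exists:
  assumes v: "w \<sqsubseteq> v" and p: "M v p P" and q: "M v q P"
  shows "\<exists>r\<in>D v. sound v r \<and> MEET v L r p q"
proof -
  have vv: "v \<sqsubseteq> v" "P \<in> D v" "L \<in> D v" and pq: "p \<in> D v" "q \<in> D v" using above[OF v] p q M_D by blast+
  obtain a where a: "a \<in> D v" "UP v a p q" using pairing[OF vv(1) pq] .
  obtain b where b: "b \<in> D v" "\<And>v' x. v \<sqsubseteq> v' \<Longrightarrow> M v' x b = (M v' x P \<and> REL v' L x p \<and> REL v' L x q)"
    using down_exists[OF vv pq] by metis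
  obtain r where r: "r \<in> D v" "PAIR v r a b" using PAIR_exists[OF vv(1) a(1) b(1)] .
  have "sound v r"
  proof (rule SOUNDI[OF a(1) b(1) r(2)])
    show "SUB v b P" unfolding SUB_def using b(2) by blast
    show "SUB v a P" using SUB_UP[OF a(2) vv(1) p q] .
    show "FIN v a" using FIN_upair[OF vv(1) pq a(2)] .
    fix v' \<alpha> assume v': "v \<sqsubseteq> v'" and \<alpha>: "is_point v' \<alpha>" and sub: "SUB v' a \<alpha>"
    have v'': "v' \<sqsubseteq> v'" using le_reflD[OF v'] by blast
    have "M v' p \<alpha>" "M v' q \<alpha>"
      using SUB_D[OF sub v''] UP_in[OF UP_mono[OF v' a(2)] v''] D_mono[OF v'] pq by blast+
    then obtain c where c: "M v' c \<alpha>" "REL v' L c p" "REL v' L c q"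
      using pointD(3)[OF \<alpha>] v'' by blast
    moreover have "M v' c P" using SUB_D[OF pointD(1)[OF \<alpha>] v'' c(1)] .
    ultimately show "\<exists>x. M v' x b \<and> M v' x \<alpha>" using b(2)[OF v'] by blast
  qed
  moreover have "MEET v L r p q" unfolding MEET_def using r(2) a b by blast
  ultimately show ?thesis using r(1) by blast
qed

text \<open>Points obey \<open>({a}, S)\<close> by their covering clause; the cover, being a forced
  formula, persists to the world of the point.\<close>

lemma cover_rule_exists:
  assumes v: "w \<sqsubseteq> v" and a: "M v a P" and S: "S \<in> D v" "SUB v S P" "cov v a S"
  shows "\<exists>r\<in>D v. sound v r \<and> COVER_RULE v r a S"
proof -
  have vv: "v \<sqsubseteq> v" and aD: "a \<in> D v" using above[OF v] a M_D by blast+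
  obtain x where x: "x \<in> D v" "UP v x a a" using pairing[OF vv aD aD] .
  obtain r where r: "r \<in> D v" "PAIR v r x S" using PAIR_exists[OF vv x(1) S(1)] .
  have "sound v r"
  proof (rule SOUNDI[OF x(1) S(1) r(2)])
    show "SUB v S P" by fact
    show "SUB v x P" using SUB_UP[OF x(2) vv a a] .
    show "FIN v x" using FIN_upair[OF vv aD aD x(2)] .
    fix v' \<alpha> assume v': "v \<sqsubseteq> v'" and \<alpha>: "is_point v' \<alpha>" and sub: "SUB v' x \<alpha>"
    have v'': "v' \<sqsubseteq> v'" using le_reflD[OF v'] by blast
    have "M v' a \<alpha>"
      using SUB_D[OF sub v''] UP_in[OF UP_mono[OF v' x(2)] v''] D_mono[OF v'] aD by blast
    moreover have "S \<in> D v'" "SUB v' S P" "cov v' a S"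
      using D_mono[OF v'] SUB_mono[OF v'] COV_mono[OF v'] S by blast+
    ultimately show "\<exists>y. M v' y S \<and> M v' y \<alpha>" using pointD(4)[OF \<alpha>] v'' by blast
  qed
  moreover have "SUB v S S" unfolding SUB_def by blast
  then have "COVER_RULE v r a S" unfolding COVER_RULE_def using r(2) x S(1) by blast
  ultimately show ?thesis using r(1) by blast
qed

text \<open>Closure under this rule says that a subset of \<open>P\<close> is inhabited. The empty
  set is taken from Infinity, as the zero of omega.\<close>

lemma inhabited_rule_exists:
  obtains r e where "r \<in> D w" "e \<in> D w" "PAIR w r e P" "EMPTY w e" "sound w r"
proof -
  obtain b where b: "OMEGA w b" using infinity[OF w D(1)] by blast
  then obtain e where e: "M w e b" "EMPTY w e" unfolding OMEGA_def INDUCTIVE_def by blast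
  then have eD: "e \<in> D w" using M_D by blast
  obtain r where r: "r \<in> D w" "PAIR w r e P" using PAIR_exists[OF w eD D(1)] .
  have "sound w r"
  proof (rule SOUNDI[OF eD D(1) r(2)])
    show "SUB w e P" using e(2) unfolding SUB_def EMPTY_def by blast
    show "SUB w P P" unfolding SUB_def by blast
    show "FIN w e" using FIN_empty[OF w eD e(2)] .
    fix v \<alpha> assume v: "w \<sqsubseteq> v" and \<alpha>: "is_point v \<alpha>"
    then show "\<exists>x. M v x P \<and> M v x \<alpha>"
      using pointD(2)[OF \<alpha>] SUB_D[OF pointD(1)[OF \<alpha>]] le_reflD[OF v] by blast
  qed
  with r eD e that show thesis by blast
qed

lemma rules_at_exist:
  assumes v: "w \<sqsubseteq> v" and a: "M v a P"
  shows "\<exists>Y\<in>D v. rules v Y a"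
proof -
  have vv: "v \<sqsubseteq> v" "P \<in> D v" "L \<in> D v" "range \<rho> \<subseteq> D v" and aD: "a \<in> D v"
    using above[OF v] a M_D by blast+
  have es: "set [P, L, a] \<subseteq> D v" using vv aD by simp
  have up: "w \<sqsubseteq> v'" "M v' a P" if "v \<sqsubseteq> v'" for v' using le_trans v M_mono a that by blast+
  \<comment> \<open>Levels 0, 1, 2 are \<open>P\<close>, \<open>L\<close>, \<open>a\<close>; level 3
    is the rule and level 4 the element \<open>q\<close> over which rules are collected.\<close>
  let ?F = "sound_rule 0 1 (class_rel cover) 3 \<^bold>\<and> meet_rule 1 3 2 4"
  have F: "holds \<rho> v' ([P, L, a] @ [r, q]) ?F \<longleftrightarrow> sound v' r \<and> MEET v' L r a q" for v' r q by simp
  obtain Y where Y: "Y \<in> D v"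
    "\<And>v' q. v \<sqsubseteq> v' \<Longrightarrow> M v' q P \<Longrightarrow> \<exists>r. M v' r Y \<and> sound v' r \<and> MEET v' L r a q"
    "\<And>v' r. v \<sqsubseteq> v' \<Longrightarrow> M v' r Y \<Longrightarrow> \<exists>q. M v' q P \<and> sound v' r \<and> MEET v' L r a q"
    by (rule collection[OF vv(1,2) es vv(4), of ?F, unfolded F]) (use meet_rule_exists up in blast)+
  obtain B where B: "B \<in> D v" "\<And>v' S. v \<sqsubseteq> v' \<Longrightarrow> M v' S B \<Longrightarrow> SUB v' S P"
    "\<And>v' U. v \<sqsubseteq> v' \<Longrightarrow> U \<in> D v' \<Longrightarrow> SUB v' U P \<Longrightarrow> cov v' a U = (\<exists>S. M v' S B \<and> SUB v' S U)"
    using presented[OF v a] by blast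
  \<comment> \<open>A member of \<open>B\<close> includes itself and is therefore a cover of
    \<open>a\<close>.\<close>
  have basic: "\<exists>r\<in>D v'. sound v' r \<and> COVER_RULE v' r a S" if v': "v \<sqsubseteq> v'" and S: "M v' S B" for v' S
  proof (rule cover_rule_exists[OF up[OF v']])
    show "S \<in> D v'" "SUB v' S P" using M_D S B(2)[OF v' S] by blast+
    moreover have "SUB v' S S" unfolding SUB_def by blast
    ultimately show "cov v' a S" using B(3)[OF v'] S by blast
  qed
  let ?G = "sound_rule 0 1 (class_rel cover) 3 \<^bold>\<and> cover_rule 3 2 4"
  have G: "holds \<rho> v' ([P, L, a] @ [r, S]) ?G \<longleftrightarrow> sound v' r \<and> COVER_RULE v' r a S" for v' r S by simp
  obtain Z where Z: "Z \<in> D v"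
    "\<And>v' S. v \<sqsubseteq> v' \<Longrightarrow> M v' S B \<Longrightarrow> \<exists>r. M v' r Z \<and> sound v' r \<and> COVER_RULE v' r a S"
    "\<And>v' r. v \<sqsubseteq> v' \<Longrightarrow> M v' r Z \<Longrightarrow> \<exists>S. M v' S B \<and> sound v' r \<and> COVER_RULE v' r a S"
    by (rule collection[OF vv(1) B(1) es vv(4), of ?G, unfolded G]) (use basic in blast)+
  obtain W where W: "W \<in> D v" "\<And>v' r. v \<sqsubseteq> v' \<Longrightarrow> M v' r W = (M v' r Y \<or> M v' r Z)"
    using binary_union[OF vv(1) Y(1) Z(1)] by metis
  have "rules v W a"
    unfolding RULES_AT_def
  proof (intro conjI allI impI)
    show "sound v' r" if "v \<sqsubseteq> v'" "M v' r W" for v' r using that W(2) Y(3) Z(3) by blast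
    show "\<exists>r. M v' r W \<and> MEET v' L r a q" if "v \<sqsubseteq> v'" "M v' q P" for v' q using that W(2) Y(2) by blast
    show "\<exists>r. M v' r W \<and> COVER_RULE v' r a S"
      if v': "v \<sqsubseteq> v'" and S: "S \<in> D v'" "SUB v' S P" "cov v' a S" for v' S
    proof -
      \<comment> \<open>\<open>S\<close> ranges over a class, but it includes some \<open>S'\<close>
        in \<open>B\<close>, whose rule is a \<open>COVER_RULE\<close> for \<open>S\<close> as
        well.\<close>
      obtain S' where S': "M v' S' B" "SUB v' S' S" using B(3)[OF v'] S by blast
      obtain r where r: "M v' r Z" "COVER_RULE v' r a S'" using Z(2)[OF v' S'(1)] by blast
      then have "COVER_RULE v' r a S" using S'(2) unfolding COVER_RULE_def SUB_def by blast
      then show ?thesis using r(1) W(2)[OF v'] by blast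
    qed
  qed
  then show ?thesis using W(1) by blast
qed

text \<open>Soundness and sufficiency. The rule giving inhabitedness is asked for at
  \<open>w\<close> only, since it persists; the other clauses range over later worlds, where new
  elements and covers can appear.\<close>

definition rule_set :: "nat \<Rightarrow> bool" where
  "rule_set R \<longleftrightarrow> (\<forall>v r. w \<sqsubseteq> v \<longrightarrow> M v r R \<longrightarrow> sound v r) \<and>
    (\<exists>r e. M w r R \<and> e \<in> D w \<and> PAIR w r e P \<and> EMPTY w e) \<and>
    (\<forall>v p q. w \<sqsubseteq> v \<longrightarrow> M v p P \<longrightarrow> M v q P \<longrightarrow> (\<exists>r. M v r R \<and> MEET v L r p q)) \<and>
    (\<forall>v a S. w \<sqsubseteq> v \<longrightarrow> M v a P \<longrightarrow> S \<in> D v \<longrightarrow> SUB v S P \<longrightarrow> cov v a S \<longrightarrow>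
      (\<exists>r. M v r R \<and> COVER_RULE v r a S))"

lemma rule_set_exists: "\<exists>R\<in>D w. rule_set R"
proof -
  have es: "set [P, L] \<subseteq> D w" using D by simp
  let ?F = "rules_at 0 1 (class_rel cover) 2 3"
  have F: "holds \<rho> v ([P, L] @ [Y, a]) ?F \<longleftrightarrow> rules v Y a" for v Y a by simp
  \<comment> \<open>By the second half of Strong Collection each member of \<open>C\<close> is a set
    of rules for some \<open>a\<close>, so the union of \<open>C\<close> contains sound rules
    only.\<close>
  obtain C where C: "C \<in> D w"
    "\<And>v a. w \<sqsubseteq> v \<Longrightarrow> M v a P \<Longrightarrow> \<exists>Y. M v Y C \<and> rules v Y a"
    "\<And>v Y. w \<sqsubseteq> v \<Longrightarrow> M v Y C \<Longrightarrow> \<exists>a. M v a P \<and> rules v Y a"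
    by (rule collection[OF w D(1) es D(3), of ?F, unfolded F]) (use rules_at_exist in blast)+
  obtain K where K: "K \<in> D w" "\<And>v r. w \<sqsubseteq> v \<Longrightarrow> M v r K = (\<exists>Y. M v Y C \<and> M v r Y)"
    using union[OF w C(1)] by metis
  obtain r0 e where r0: "r0 \<in> D w" "e \<in> D w" "PAIR w r0 e P" "EMPTY w e" "sound w r0"
    using inhabited_rule_exists .
  obtain s where s: "s \<in> D w" "UP w s r0 r0" using pairing[OF w r0(1) r0(1)] .
  obtain R where R: "R \<in> D w" "\<And>v r. w \<sqsubseteq> v \<Longrightarrow> M v r R = (M v r K \<or> M v r s)"
    using binary_union[OF w K(1) s(1)] by metis
  have "rule_set R"
    unfolding rule_set_def
  proof (intro conjI allI impI)
    show "sound v r" if v: "w \<sqsubseteq> v" and r: "M v r R" for v r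
    proof (cases "M v r K")
      case True
      then obtain Y where Y: "M v Y C" "M v r Y" using K(2)[OF v] by blast
      then obtain a where "rules v Y a" using C(3)[OF v] by blast
      then show ?thesis using rulesD(1) Y(2) above[OF v] by blast
    next
      case False
      \<comment> \<open>\<open>r\<close> and \<open>r0\<close> are equal in the model without being
        identical, so soundness is carried over by congruence of pairs.\<close>
      then have e: "E v r0 r" using R(2)[OF v] r UP_iff[OF s(2) v] E_sym by blast
      have "PAIR v r a b" if "PAIR v r0 a b" "a \<in> D v" "b \<in> D v" for a b
        using PAIR_cong[OF that(1) e] E_refl that above[OF v] by blast
      then show ?thesis using sound_mono[OF v r0(5)] unfolding SOUND_def by blast
    qed
    show "\<exists>r e. M w r R \<and> e \<in> D w \<and> PAIR w r e P \<and> EMPTY w e"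
      using R(2)[OF w] UP_in[OF s(2) w] r0 by blast
    show "\<exists>r. M v r R \<and> MEET v L r p q" if v: "w \<sqsubseteq> v" and p: "M v p P" and q: "M v q P" for v p q
    proof -
      obtain Y where Y: "M v Y C" "rules v Y p" using C(2)[OF v p] by blast
      then obtain r where "M v r Y" "MEET v L r p q" using rulesD(2)[OF Y(2) _ q] above[OF v] by blast
      then show ?thesis using R(2)[OF v] K(2)[OF v] Y(1) by blast
    qed
    show "\<exists>r. M v r R \<and> COVER_RULE v r a S"
      if v: "w \<sqsubseteq> v" and a: "M v a P" and S: "S \<in> D v" "SUB v S P" "cov v a S" for v a S
    proof -
      obtain Y where Y: "M v Y C" "rules v Y a" using C(2)[OF v a] by blast
      then obtain r where "M v r Y" "COVER_RULE v r a S" using rulesD(3)[OF Y(2) _ S] above[OF v] by blast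
      then show ?thesis using R(2)[OF v] K(2)[OF v] Y(1) by blast
    qed
  qed
  then show ?thesis using R(1) by blast
qed

text \<open>Points are closed because all rules are sound; closed subsets are points because there
  are enough rules. Every \<open>v\<close> above \<open>w\<close> is included, as forcing
  set-generation speaks of later worlds.\<close>

lemma closed_iff_point:
  assumes "rule_set R" and v: "w \<sqsubseteq> v" and \<alpha>D: "\<alpha> \<in> D v"
  shows "CLOSED v P R \<alpha> \<longleftrightarrow> is_point v \<alpha>"
proof -
  have R: "\<And>v r. w \<sqsubseteq> v \<Longrightarrow> M v r R \<Longrightarrow> sound v r"
    "\<exists>r e. M w r R \<and> e \<in> D w \<and> PAIR w r e P \<and> EMPTY w e"
    "\<And>v p q. w \<sqsubseteq> v \<Longrightarrow> M v p P \<Longrightarrow> M v q P \<Longrightarrow> \<exists>r. M v r R \<and> MEET v L r p q"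
    "\<And>v a S. w \<sqsubseteq> v \<Longrightarrow> M v a P \<Longrightarrow> S \<in> D v \<Longrightarrow> SUB v S P \<Longrightarrow> cov v a S \<Longrightarrow>
      \<exists>r. M v r R \<and> COVER_RULE v r a S"
    using assms(1) unfolding rule_set_def by simp_all
  show ?thesis
  proof
    assume \<alpha>: "is_point v \<alpha>"
    show "CLOSED v P R \<alpha>"
      unfolding CLOSED_def
    proof (intro conjI allI impI)
      show "SUB v \<alpha> P" using pointD(1)[OF \<alpha>] .
      fix v' r a b
      assume v': "v \<sqsubseteq> v'" and r: "M v' r R" and ab: "a \<in> D v'" "b \<in> D v'" "PAIR v' r a b" "SUB v' a \<alpha>"
      have wv': "w \<sqsubseteq> v'" using le_trans v v' by blast
      then have v'': "v' \<sqsubseteq> v'" using le_reflD by blast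
      have pt: "is_point v' \<alpha>" "\<alpha> \<in> D v'" using point_mono[OF v' \<alpha>] D_mono[OF v' \<alpha>D] by blast+
      obtain a' b' where ab': "a' \<in> D v'" "b' \<in> D v'" "PAIR v' r a' b'"
        and sound: "\<And>u \<alpha>. v' \<sqsubseteq> u \<Longrightarrow> \<alpha> \<in> D u \<Longrightarrow> is_point u \<alpha> \<Longrightarrow> SUB u a' \<alpha> \<Longrightarrow> \<exists>x. M u x b' \<and> M u x \<alpha>"
        using R(1)[OF wv' r] unfolding SOUND_def by blast
      \<comment> \<open>Soundness comes with its own components \<open>a'\<close>, \<open>b'\<close>
        of the rule; injectivity of pairs identifies them with the given ones.\<close>
      have e: "E v' a' a" "E v' b' b"
        using PAIR_inject[OF v'' ab'(1,2) ab(1,2) ab'(3) ab(3)] by blast+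
      have "SUB v' a' \<alpha>"
        unfolding SUB_def using ab(4) E_mono[OF _ e(1)] M_cong_right unfolding SUB_def by blast
      then obtain x where "M v' x b'" "M v' x \<alpha>" using sound[OF v'' pt(2,1)] by blast
      then show "\<exists>x. M v' x b \<and> M v' x \<alpha>" using M_cong_right e(2) by blast
    qed
  next
    assume closed: "CLOSED v P R \<alpha>"
    have sub: "SUB v \<alpha> P" using closed unfolding CLOSED_def by blast
    have rule: "\<exists>x. M v' x b \<and> M v' x \<alpha>"
      if "v \<sqsubseteq> v'" "M v' r R" "a \<in> D v'" "b \<in> D v'" "PAIR v' r a b" "SUB v' a \<alpha>" for v' r a b
      using closed that unfolding CLOSED_def by blast
    have vv: "v \<sqsubseteq> v" using above[OF v] by blast
    have up: "w \<sqsubseteq> v'" "v' \<sqsubseteq> v'" if "v \<sqsubseteq> v'" for v' using le_trans v le_reflD that by blast+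
    have in_P: "M v' p P" if "v \<sqsubseteq> v'" "M v' p \<alpha>" for v' p using SUB_D[OF sub] that by blast
    \<comment> \<open>This is the covering clause of a point, and applied to a singleton cover it
      gives upward closure.\<close>
    have covered: "\<exists>x. M v' x S \<and> M v' x \<alpha>"
      if v': "v \<sqsubseteq> v'" and a: "M v' a \<alpha>" and S: "S \<in> D v'" "SUB v' S P" "cov v' a S" for v' a S
    proof -
      obtain r where r: "M v' r R" "COVER_RULE v' r a S"
        using R(4)[OF up(1)[OF v'] in_P[OF v' a] S] by blast
      then obtain x y where xy: "x \<in> D v'" "y \<in> D v'" "PAIR v' r x y" "UP v' x a a" "SUB v' y S"
        unfolding COVER_RULE_def by blast
      obtain z where "M v' z y" "M v' z \<alpha>"
        using rule[OF v' r(1) xy(1-3) SUB_UP[OF xy(4) up(2)[OF v'] a a]] by blast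
      then show ?thesis using SUB_D[OF xy(5) up(2)[OF v']] by blast
    qed
    show "is_point v \<alpha>"
      unfolding POINT_def
    proof (intro conjI allI impI)
      show "SUB v \<alpha> P" by fact
      obtain r e where r: "M w r R" "e \<in> D w" "PAIR w r e P" "EMPTY w e" using R(2) by blast
      then have "M v r R" "e \<in> D v" "PAIR v r e P" "EMPTY v e"
        using M_mono[OF v] D_mono[OF v] PAIR_mono[OF v] EMPTY_mono[OF v] by blast+
      moreover from this have "SUB v e \<alpha>" unfolding SUB_def EMPTY_def by blast
      ultimately show "\<exists>p. M v p \<alpha>" using rule[OF vv, of r e P] above[OF v] by blast
    next
      fix v' p q assume v': "v \<sqsubseteq> v'" and p: "M v' p \<alpha>" and q: "M v' q P" and pq: "REL v' L p q"
      note v'' = up[OF v']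
      have qD: "q \<in> D v'" using q M_D by blast
      obtain U where U: "U \<in> D v'" "UP v' U q q" using pairing[OF v''(2) qD qD] .
      have "SUB v' U P" "M v' q U" using SUB_UP[OF U(2) v''(2) q q] UP_in[OF U(2) v''(2)] qD by blast+
      then have "cov v' p U"
        using cov_le[OF v''(1) in_P[OF v' p] q U(1) _ pq] cov_mem[OF v''(1) q U(1)] by blast
      then obtain x where "M v' x U" "M v' x \<alpha>" using covered[OF v' p U(1) \<open>SUB v' U P\<close>] by blast
      then show "M v' q \<alpha>" using UP_iff[OF U(2) v''(2)] M_cong_left by blast
    next
      fix v' p q assume v': "v \<sqsubseteq> v'" and p: "M v' p \<alpha>" and q: "M v' q \<alpha>"
      note v'' = up[OF v']
      obtain r where r: "M v' r R" "MEET v' L r p q"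
        using R(3)[OF v''(1) in_P[OF v' p] in_P[OF v' q]] by blast
      then obtain a b where ab: "a \<in> D v'" "b \<in> D v'" "PAIR v' r a b" "UP v' a p q"
        "\<And>u c. v' \<sqsubseteq> u \<Longrightarrow> M u c b \<Longrightarrow> REL u L c p \<and> REL u L c q"
        unfolding MEET_def by blast
      show "\<exists>r. M v' r \<alpha> \<and> REL v' L r p \<and> REL v' L r q"
        using rule[OF v' r(1) ab(1-3) SUB_UP[OF ab(4) v''(2) p q]] ab(5)[OF v''(2)] by blast
    next
      fix v' a S assume "v \<sqsubseteq> v'" "M v' a \<alpha>" "S \<in> D v'" "SUB v' S P" "cov v' a S"
      then show "\<exists>x. M v' x S \<and> M v' x \<alpha>" by (rule covered)
    qed
  qed
qed

text \<open>Closed subsets and points agree at every world above \<open>w\<close>, so the generating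
  set that NID supplies for the rules also generates the points.\<close>

lemma set_generated_points:
  assumes NID: "forces w (\<lambda>_. P) (formula finitary_NID)"
  shows "holds \<rho> w [P, L] (set_generated (point 0 1 (class_rel cover)))"
proof -
  obtain R where RD: "R \<in> D w" and R: "rule_set R" using rule_set_exists by blast
  note eq = closed_iff_point[OF R]
  have "\<forall>v r. w \<sqsubseteq> v \<longrightarrow> M v r R \<longrightarrow> sound v r" using R by (simp add: rule_set_def)
  then have "holds (\<lambda>_. P) w [P, R] (finitary_rule_set 0 1)"
    unfolding SOUND_def by (simp add: finitary_rule_set_def) blast
  moreover have "\<And>v X u R. w \<sqsubseteq> v \<Longrightarrow> X \<in> D v \<Longrightarrow> v \<sqsubseteq> u \<Longrightarrow> R \<in> D u \<Longrightarrow>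
      holds (\<lambda>_. P) u [X, R] (finitary_rule_set 0 1) \<Longrightarrow>
      holds (\<lambda>_. P) u [X, R] (set_generated (closed_subset 0 1))"
    using NID by (simp add: finitary_NID_def forces_formula holds_all[of _ _ "[]"] del: holds_connectives)
  ultimately have "holds (\<lambda>_. P) w [P, R] (set_generated (closed_subset 0 1))"
    using w D(1) RD by blast
  then obtain G where G: "G \<in> D w" "\<And>v b. w \<sqsubseteq> v \<Longrightarrow> M v b G \<Longrightarrow> CLOSED v P R b"
    "\<And>v \<alpha> u x. w \<sqsubseteq> v \<Longrightarrow> \<alpha> \<in> D v \<Longrightarrow> CLOSED v P R \<alpha> \<Longrightarrow> v \<sqsubseteq> u \<Longrightarrow> M u x \<alpha> \<Longrightarrow>
      \<exists>b. M u b G \<and> M u x b \<and> SUB u b \<alpha>"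
    using le_reflD by (auto simp: set_generated_def)
  have "is_point v b" if "w \<sqsubseteq> v" "M v b G" for v b using G(2) eq M_D that by blast
  moreover have "\<exists>b. M u b G \<and> M u x b \<and> SUB u b \<alpha>"
    if "w \<sqsubseteq> v" "\<alpha> \<in> D v" "is_point v \<alpha>" "v \<sqsubseteq> u" "M u x \<alpha>" for v \<alpha> u x
    using G(3) eq that by blast
  ultimately show ?thesis
    unfolding set_generated_def holds_ex by (intro bexI[of _ G]) (simp_all add: G(1))
qed

end

section \<open>From the forced hypotheses to the theorem\<close>

lemma (in czf_model) presented_spaceI:
  assumes w: "w \<sqsubseteq> w" and D: "P \<in> D w" "L \<in> D w" "range \<rho> \<subseteq> D w"
    and fs: "holds \<rho> w [P, L] (formal_space 0 1 (class_rel cover))"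
    and sp: "holds \<rho> w [P, L] (set_presented 0 (class_rel cover))"
  shows "presented_space (\<sqsubseteq>) D M E cover \<rho> w P L"
proof
  show "w \<sqsubseteq> w" "P \<in> D w" "L \<in> D w" "range \<rho> \<subseteq> D w" by fact+
  fix v a assume v: "w \<sqsubseteq> v" and a: "M v a P"
  have vv: "v \<sqsubseteq> v" using le_reflD[OF v] by blast
  show "COV cover \<rho> v a U" if U: "U \<in> D v" "SUB v U P" "M v a U" for U
  proof -
    have "holds \<rho> w [P, L] (\<^bold>\<forall>a\<^bold>\<in>0. \<^bold>\<forall>U\<^bold>\<subseteq>0. a \<^bold>\<in> U \<^bold>\<longrightarrow> class_rel cover a U)"
      using fs unfolding formal_space_def holds_connectives by blast
    then show ?thesis using v vv a U by simp
  qed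
  show "COV cover \<rho> v a U"
    if b: "M v b P" and U: "U \<in> D v" "SUB v U P" "REL v L a b" "COV cover \<rho> v b U" for b U
  proof -
    have "holds \<rho> w [P, L] (\<^bold>\<forall>a\<^bold>\<in>0. \<^bold>\<forall>b\<^bold>\<in>0. \<^bold>\<forall>U\<^bold>\<subseteq>0.
        related 1 a b \<^bold>\<and> class_rel cover b U \<^bold>\<longrightarrow> class_rel cover a U)"
      using fs unfolding formal_space_def holds_connectives by blast
    \<comment> \<open>Each quantifier and the implication bring a world of their own; the chain is
      then taken constant at \<open>v\<close>.\<close>
    then have "\<And>v1 a v2 b v3 U v4. w \<sqsubseteq> v1 \<Longrightarrow> M v1 a P \<Longrightarrow> v1 \<sqsubseteq> v2 \<Longrightarrow> M v2 b P \<Longrightarrow> v2 \<sqsubseteq> v3 \<Longrightarrow>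
        U \<in> D v3 \<Longrightarrow> SUB v3 U P \<Longrightarrow> v3 \<sqsubseteq> v4 \<Longrightarrow> REL v4 L a b \<Longrightarrow> COV cover \<rho> v4 b U \<Longrightarrow> COV cover \<rho> v4 a U"
      by simp
    from this[OF v a vv b vv U(1,2) vv U(3,4)] show ?thesis .
  qed
  \<comment> \<open>The function is fixed at \<open>w\<close>; only its value \<open>B\<close> at
    \<open>a\<close> is carried further.\<close>
  obtain BCov where "\<forall>v a. w \<sqsubseteq> v \<longrightarrow> M v a P \<longrightarrow> holds \<rho> v [P, L, BCov, a]
      (\<^bold>\<exists>B. related 2 3 B \<^bold>\<and> (\<^bold>\<forall>S\<^bold>\<in>B. S \<^bold>\<subseteq> 0) \<^bold>\<and>
           (\<^bold>\<forall>U\<^bold>\<subseteq>0. class_rel cover 3 U \<^bold>\<longleftrightarrow> (\<^bold>\<exists>S\<^bold>\<in>B. S \<^bold>\<subseteq> U)))"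
    using sp unfolding set_presented_def by auto
  then have "holds \<rho> v [P, L, BCov, a]
      (\<^bold>\<exists>B. related 2 3 B \<^bold>\<and> (\<^bold>\<forall>S\<^bold>\<in>B. S \<^bold>\<subseteq> 0) \<^bold>\<and>
           (\<^bold>\<forall>U\<^bold>\<subseteq>0. class_rel cover 3 U \<^bold>\<longleftrightarrow> (\<^bold>\<exists>S\<^bold>\<in>B. S \<^bold>\<subseteq> U)))" using v a by blast
  then obtain B where B: "B \<in> D v" "\<And>v' S. v \<sqsubseteq> v' \<Longrightarrow> M v' S B \<Longrightarrow> SUB v' S P"
    "\<And>v' U v''. v \<sqsubseteq> v' \<Longrightarrow> U \<in> D v' \<Longrightarrow> SUB v' U P \<Longrightarrow> v' \<sqsubseteq> v'' \<Longrightarrow>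
      COV cover \<rho> v'' a U = (\<exists>S. M v'' S B \<and> SUB v'' S U)"
    by auto
  show "\<exists>B\<in>D v. (\<forall>v' S. v \<sqsubseteq> v' \<longrightarrow> M v' S B \<longrightarrow> SUB v' S P) \<and>
      (\<forall>v' U. v \<sqsubseteq> v' \<longrightarrow> U \<in> D v' \<longrightarrow> SUB v' U P \<longrightarrow>
        COV cover \<rho> v' a U = (\<exists>S. M v' S B \<and> SUB v' S U))"
    using B le_reflD by (intro bexI[of _ B]) blast+
qed

theorem (in czf_model) points_set_generated:
  assumes NID: "\<And>w \<rho>. w \<sqsubseteq> w \<Longrightarrow> range \<rho> \<subseteq> D w \<Longrightarrow> forces w \<rho> (formula finitary_NID)"
    and w: "w \<sqsubseteq> w" and \<rho>: "range \<rho> \<subseteq> D w"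
  shows "forces w \<rho> (formula (\<^bold>\<forall>P L.
      formal_space P L (class_rel cover) \<^bold>\<and> set_presented P (class_rel cover) \<^bold>\<longrightarrow>
      set_generated (point P L (class_rel cover))))"
proof -
  \<comment> \<open>The two outer quantifiers and the implication introduce the worlds
    \<open>v\<close>, \<open>u\<close>, \<open>t\<close> in turn; the argument takes place at
    \<open>t\<close>, where the hypotheses are forced.\<close>
  have main: "holds \<rho> t [P, L] (set_generated (point 0 1 (class_rel cover)))"
    if le: "w \<sqsubseteq> v" "v \<sqsubseteq> u" "u \<sqsubseteq> t" and PL: "P \<in> D v" "L \<in> D u"
      and hyps: "holds \<rho> t [P, L] (formal_space 0 1 (class_rel cover))"
        "holds \<rho> t [P, L] (set_presented 0 (class_rel cover))"
    for v u t P L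
  proof -
    have t: "w \<sqsubseteq> t" "v \<sqsubseteq> t" "t \<sqsubseteq> t" using le le_trans le_reflD by blast+
    have D: "P \<in> D t" "L \<in> D t" "range \<rho> \<subseteq> D t"
      using D_mono[OF t(2) PL(1)] D_mono[OF le(3) PL(2)] D_mono[OF t(1)] \<rho> by blast+
    interpret presented_space "(\<sqsubseteq>)" D M E cover \<rho> t P L
      using presented_spaceI[OF t(3) D hyps] .
    have "forces t (\<lambda>_. P) (formula finitary_NID)" using NID[OF t(3), of "\<lambda>_. P"] D(1) by auto
    then show ?thesis by (rule set_generated_points)
  qed
  show ?thesis
    unfolding forces_formula holds_all holds_connectives
  proof (intro allI ballI impI)
    fix v P u L t
    assume "w \<sqsubseteq> v" "P \<in> D v" "v \<sqsubseteq> u" "L \<in> D u" "u \<sqsubseteq> t"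
      "holds \<rho> t (([] @ [P]) @ [L]) (formal_space (length []) (length ([] @ [P])) (class_rel cover)) \<and>
       holds \<rho> t (([] @ [P]) @ [L]) (set_presented (length []) (class_rel cover))"
    then show "holds \<rho> t (([] @ [P]) @ [L])
        (set_generated (point (length []) (length ([] @ [P])) (class_rel cover)))"
      using main[of v u t P L] by simp
  qed
qed

text \<open>The cover is an arbitrary formula with parameters, so this is a scheme with one instance
  for each class relation. The canonical model qualifies as a model of the axioms because its worlds
  are deductively closed.\<close>

theorem theorem5p1:
  fixes cover :: fm
  shows "CZF \<union> {formula finitary_NID} \<turnstile>
    formula (\<^bold>\<forall>P L.
      formal_space P L (class_rel cover) \<^bold>\<and> set_presented P (class_rel cover) \<^bold>\<longrightarrow>
      set_generated (point P L (class_rel cover)))"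
    (is "?T \<turnstile> _")
proof (rule completeness)
  fix w :: world and \<rho> :: "nat \<Rightarrow> nat"
  assume w: "world ?T w" "range \<rho> \<subseteq> snd w"
  have "czf_model (world_le ?T) snd (canonical_mem ?T) (canonical_eq ?T)"
    by unfold_locales (auto simp: world_le_def intro: canonical_axiom)
  then show "canonical.forces ?T w \<rho> (formula (\<^bold>\<forall>P L.
      formal_space P L (class_rel cover) \<^bold>\<and> set_presented P (class_rel cover) \<^bold>\<longrightarrow>
      set_generated (point P L (class_rel cover))))"
    by (rule czf_model.points_set_generated) (use w in \<open>auto simp: world_le_def intro: canonical_axiom\<close>)
qed

end
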